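(* Let $x_1,\ldots,x_J \in \mathbb{R}^d$ be given, let $\rho \ge 0$, $\widehat\mu \in \mathbb{R}^d$ and $\widehat\Sigma \in \mathbb{S}_+^d$. Define $$\Theta(\{x_j\}) = \{\theta \in \mathbb{R}^d : x_j^\top \theta \ge 0 \ \forall j \in [J]\},\qquad \Theta^\circ(\{x_j\}) = \{\theta \in \mathbb{R}^d : x_j^\top \theta > 0 \ \forall j \in [J]\},$$ and let $\mathbb{B}$ be the set of all probability measures $\mathbb{Q}$ on $\mathbb{R}^d$ for which there exists $(\mu,\Sigma) \in \mathbb{R}^d \times \mathbb{S}_+^d$ with $\mathbb{G}((\mu,\Sigma),(\widehat\mu,\widehat\Sigma)) \le \rho$ such that the random vector $\tilde\theta \sim \mathbb{Q}$ has mean $\mu$ and covariance matrix $\Sigma$. Let $L^\star$ be the optimal value of the semidefinite program $$ L^\star = \left\{ \begin{array}{cl} \inf & 1 - \sum_{j \in [J]} \lambda_j \\ \text{s.t.} & \mu \in \mathbb{R}^d,\ \Sigma \in \mathbb{S}_+^d,\ C \in \mathbb{R}^{d\times d},\ M \in \mathbb{S}_+^d,\\ & \lambda_j \in \mathbb{R},\ z_j \in \mathbb{R}^d,\ Z_j \in \mathbb{S}^d \quad \forall j \in [J],\\ & -x_j^\top z_j \ge 0,\quad \begin{bmatrix} Z_j & z_j \\ z_j^\top & \lambda_j \end{bmatrix} \succeq 0 \quad \forall j \in [J],\\ & \sum_{j\in[J]} \begin{bmatrix} Z_j & z_j \\ z_j^\top & \lambda_j \end{bmatrix} \preceq \begin{bmatrix}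 M & \mu \\ \mu^\top & 1\end{bmatrix},\quad \begin{bmatrix} \Sigma & C \\ C^\top & \widehat\Sigma \end{bmatrix} \succeq 0,\quad \begin{bmatrix} M - \Sigma & \mu \\ \mu^\top & 1\end{bmatrix} \succeq 0,\\ & \|\widehat\mu\|^2 - 2\widehat\mu^\top \mu + \mathrm{Tr}(M + \widehat\Sigma - 2C) \le \rho^2. \end{array}\right. $$ Then $$L^\star = \inf_{\mathbb{Q} \in \mathbb{B}} \mathbb{Q}(\tilde\theta \in \Theta^\circ(\{x_j\})) \le \inf_{\mathbb{Q}\in\mathbb{B}} \mathbb{Q}(\tilde\theta \in \Theta(\{x_j\})).$$
   Context: $\mathbb{S}^d$ denotes the symmetric $d\times d$ matrices, $\mathbb{S}_+^d$ the positive semidefinite ones, $[J]=\{1,\ldots,J\}$. The Gelbrich distance between $(\mu_1,\Sigma_1),(\mu_2,\Sigma_2) \in \mathbb{R}^d\times\mathbb{S}_+^d$ is $$\mathbb{G}((\mu_1,\Sigma_1),(\mu_2,\Sigma_2)) = \sqrt{\|\mu_1-\mu_2\|_2^2 + \mathrm{Tr}\big(\Sigma_1+\Sigma_2 - 2(\Sigma_2^{1/2}\Sigma_1\Sigma_2^{1/2})^{1/2}\big)}.$$ $\tilde\theta$ denotes the random vector with law $\mathbb{Q}$ (interpreted as the random parameter of a linear classifier $x \mapsto 1$ if $\theta^\top x \ge 0$). *)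

theory Defs
  imports "HOL-Analysis.Analysis" "HOL-Probability.Probability"
begin

definition symm :: "real^'m^'m \<Rightarrow> bool" where
  "symm A \<longleftrightarrow> transpose A = A"

definition psd :: "real^'m^'m \<Rightarrow> bool" where
  "psd A \<longleftrightarrow> symm A \<and> (\<forall>v. 0 \<le> v \<bullet> (A *v v))"

definition loewner_le :: "real^'m^'m \<Rightarrow> real^'m^'m \<Rightarrow> bool" where
  "loewner_le A B \<longleftrightarrow> psd (B - A)"

definition msqrt :: "real^'m^'m \<Rightarrow> real^'m^'m" where
  "msqrt A = (THE S. psd S \<and> S ** S = A)"

definition gelbrich :: "((real^'n) \<times> (real^'n^'n)) \<Rightarrow> ((real^'n) \<times> (real^'n^'n)) \<Rightarrow> real" where
  "gelbrich p q = (case p of (\<mu>1, \<Sigma>1) \<Rightarrow> case q of (\<mu>2, \<Sigma>2) \<Rightarrow>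
     sqrt ((norm (\<mu>1 - \<mu>2))\<^sup>2 +
           trace (\<Sigma>1 + \<Sigma>2 - 2 *\<^sub>R msqrt (msqrt \<Sigma>2 ** \<Sigma>1 ** msqrt \<Sigma>2))))"

definition blockmat :: "real^'n^'n \<Rightarrow> real^'m^'n \<Rightarrow> real^'n^'m \<Rightarrow> real^'m^'m
    \<Rightarrow> real^('n + 'm)^('n + 'm)" where
  "blockmat A B C D = (\<chi> i j. case i of
       Inl a \<Rightarrow> (case j of Inl b \<Rightarrow> A $ a $ b | Inr b \<Rightarrow> B $ a $ b)
     | Inr a \<Rightarrow> (case j of Inl b \<Rightarrow> C $ a $ b | Inr b \<Rightarrow> D $ a $ b))"

definition colv :: "real^'n \<Rightarrow> real^unit^'n" where
  "colv z = (\<chi> i j. z $ i)"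

definition rowv :: "real^'n \<Rightarrow> real^'n^unit" where
  "rowv z = (\<chi> i j. z $ j)"

definition scal :: "real \<Rightarrow> real^unit^unit" where
  "scal c = (\<chi> i j. c)"

definition bmat :: "real^'n^'n \<Rightarrow> real^'n \<Rightarrow> real \<Rightarrow> real^('n + unit)^('n + unit)" where
  "bmat Z z l = blockmat Z (colv z) (rowv z) (scal l)"

definition has_mean_cov :: "(real^'n) measure \<Rightarrow> real^'n \<Rightarrow> real^'n^'n \<Rightarrow> bool" where
  "has_mean_cov Q \<mu> \<Sigma> \<longleftrightarrow>
     (\<forall>i. integrable Q (\<lambda>\<theta>. \<theta> $ i)) \<and>
     (\<forall>i k. integrable Q (\<lambda>\<theta>. \<theta> $ i * \<theta> $ k)) \<and>
     (\<forall>i. (\<integral>\<theta>. \<theta> $ i \<partial>Q) = \<mu> $ i) \<and>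
     (\<forall>i k. (\<integral>\<theta>. (\<theta> $ i - \<mu> $ i) * (\<theta> $ k - \<mu> $ k) \<partial>Q) = \<Sigma> $ i $ k)"

definition gelbrich_ball :: "real^'n \<Rightarrow> real^'n^'n \<Rightarrow> real \<Rightarrow> (real^'n) measure set" where
  "gelbrich_ball \<mu>h \<Sigma>h \<rho> = {Q. prob_space Q \<and> sets Q = sets borel \<and>
     (\<exists>\<mu> \<Sigma>. psd \<Sigma> \<and> gelbrich (\<mu>, \<Sigma>) (\<mu>h, \<Sigma>h) \<le> \<rho> \<and> has_mean_cov Q \<mu> \<Sigma>)}"

definition Theta :: "nat \<Rightarrow> (nat \<Rightarrow> real^'n) \<Rightarrow> (real^'n) set" where
  "Theta J x = {\<theta>. \<forall>j\<in>{1..J}. x j \<bullet> \<theta> \<ge> 0}"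

definition Theta_int :: "nat \<Rightarrow> (nat \<Rightarrow> real^'n) \<Rightarrow> (real^'n) set" where
  "Theta_int J x = {\<theta>. \<forall>j\<in>{1..J}. x j \<bullet> \<theta> > 0}"

definition sdp_values :: "nat \<Rightarrow> (nat \<Rightarrow> real^'n) \<Rightarrow> real^'n \<Rightarrow> real^'n^'n \<Rightarrow> real \<Rightarrow> real set" where
  "sdp_values J x \<mu>h \<Sigma>h \<rho> = {1 - (\<Sum>j\<in>{1..J}. lam j) | \<mu> \<Sigma> C M lam z Z.
      psd \<Sigma> \<and> psd M \<and>
      (\<forall>j\<in>{1..J}. symm (Z j) \<and> - (x j \<bullet> z j) \<ge> 0 \<and> psd (bmat (Z j) (z j) (lam j))) \<and>
      loewner_le (\<Sum>j\<in>{1..J}. bmat (Z j) (z j) (lam j)) (bmat M \<mu> 1) \<and>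
      psd (blockmat \<Sigma> C (transpose C) \<Sigma>h) \<and>
      psd (bmat (M - \<Sigma>) \<mu> 1) \<and>
      (norm \<mu>h)\<^sup>2 - 2 * (\<mu>h \<bullet> \<mu>) + trace (M + \<Sigma>h - 2 *\<^sub>R C) \<le> \<rho>\<^sup>2}"

end

theory Submission
  imports Defs
begin

text \<open>
  Replacing \<open>\<Sigma>\<close> by the covariance \<open>M - \<mu> \<mu>\<^sup>T\<close>, which is at least as large in the Loewner order,
  shows that the program ranges over the mean \<open>\<mu>\<close> and second moment matrix \<open>M\<close> of the
  measures in the ball, because the largest trace of an admissible \<open>C\<close> is the trace of the square root
  in the Gelbrich distance. For fixed moments the statement is a generalized Chebyshev bound. A measure yields a
  feasible point by cutting the complement of the open cone into disjoint pieces, the \<open>j\<close>-th one inside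
  \<open>x\<^sub>j\<^sup>T \<theta> \<le> 0\<close>, and taking the mass \<open>\<lambda>\<^sub>j\<close>, first moment \<open>z\<^sub>j\<close> and second moment \<open>Z\<^sub>j\<close>
  of each. Conversely a feasible point yields a discrete measure: an atom of mass \<open>\<lambda>\<^sub>j\<close> at
  \<open>z\<^sub>j / \<lambda>\<^sub>j\<close> for each \<open>j\<close>, and finitely many further atoms that carry the remaining mass and
  moments. If no mass remains, these atoms escape to infinity, and so all
  \<open>(Z\<^sub>j, z\<^sub>j, \<lambda>\<^sub>j)\<close> are first scaled by \<open>1 - \<epsilon>\<close>.
\<close>

subsection \<open>Diagonalization of symmetric matrices\<close>

text \<open>A maximizer \<open>u\<close> of the Rayleigh quotient on the unit sphere of
  \<open>S\<close> is an eigenvector. With the maximum \<open>c\<close>, the form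
  \<open>c * (y \<bullet> y) - y \<bullet> f y\<close> is nonnegative on \<open>S\<close> and
  vanishes at \<open>u\<close>, so its first variation at \<open>u\<close> in the direction
  \<open>c *\<^sub>R u - f u\<close> is zero.\<close>

lemma selfadjoint_eigenvector_exists:
  fixes f :: "'a::euclidean_space \<Rightarrow> 'a"
  assumes lin: "linear f" and sa: "\<And>x y. f x \<bullet> y = x \<bullet> f y"
    and S: "subspace S" "f ` S \<subseteq> S" "S \<noteq> {0}"
  obtains u c where "u \<in> S" "norm u = 1" "f u = c *\<^sub>R u"
proof -
  let ?K = "sphere 0 1 \<inter> S"
  have "compact ?K"
    using S(1) by (simp add: closed_subspace compact_Int_closed)
  moreover have "?K \<noteq> {}"
  proof -
    obtain y where y: "y \<in> S" "y \<noteq> 0" using S subspace_0 by blast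
    hence "(1 / norm y) *\<^sub>R y \<in> ?K" using S(1) by (auto simp: subspace_scale)
    thus ?thesis by blast
  qed
  moreover have "continuous_on ?K (\<lambda>x. x \<bullet> f x)"
    by (intro continuous_intros linear_continuous_on linear_linear[THEN iffD2] lin)
  ultimately obtain u where u: "u \<in> ?K" and max: "\<And>y. y \<in> ?K \<Longrightarrow> y \<bullet> f y \<le> u \<bullet> f u"
    using continuous_attains_sup[of ?K] by metis
  define c where "c = u \<bullet> f u"
  have uS: "u \<in> S" and un: "norm u = 1" and uu: "u \<bullet> u = 1" using u by (auto simp: norm_eq_1)
  have q: "y \<bullet> f y \<le> c * (y \<bullet> y)" if y: "y \<in> S" for y
  proof (cases "y = 0")
    case False
    have "(1 / norm y) *\<^sub>R y \<in> ?K" using S(1) y False by (auto simp: subspace_scale)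
    from max[OF this] have "(1 / norm y) * ((1 / norm y) * (y \<bullet> f y)) \<le> c"
      by (simp add: linear_scale[OF lin] c_def)
    hence "(y \<bullet> f y) / (norm y)\<^sup>2 \<le> c" by (simp add: power2_eq_square)
    thus ?thesis using False by (simp add: pos_divide_le_eq power2_norm_eq_inner)
  qed (simp add: linear_0[OF lin])
  define y where "y = c *\<^sub>R u - f u"
  have yS: "y \<in> S" using S uS by (auto simp: y_def subspace_diff subspace_scale)
  \<comment> \<open>This is the nonnegative form at \<open>u + t *\<^sub>R y\<close>: the constant
    term is zero, and self-adjointness turns the linear coefficient into
    \<open>2 * (y \<bullet> y)\<close>.\<close>
  have key: "0 \<le> 2 * t * (y \<bullet> y) + t\<^sup>2 * (c * (y \<bullet> y) - y \<bullet> f y)" for t :: real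
  proof -
    have "u + t *\<^sub>R y \<in> S" using S uS yS by (simp add: subspace_add subspace_scale)
    from q[OF this]
    have "0 \<le> c * ((u + t *\<^sub>R y) \<bullet> (u + t *\<^sub>R y)) - (u + t *\<^sub>R y) \<bullet> f (u + t *\<^sub>R y)" by simp
    also have "\<dots> = c * (u \<bullet> u) - u \<bullet> f u + t * (2 * (c * (u \<bullet> y)) - y \<bullet> f u - u \<bullet> f y) + t\<^sup>2 * (c * (y \<bullet> y) - y \<bullet> f y)"
      by (simp add: linear_add[OF lin] linear_scale[OF lin] inner_simps power2_eq_square
          inner_commute[of y u] algebra_simps)
    also have "u \<bullet> f y = y \<bullet> f u" using sa[of u y] by (simp add: inner_commute)
    also have "2 * (c * (u \<bullet> y)) - y \<bullet> f u - y \<bullet> f u = 2 * (y \<bullet> y)"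
      by (simp add: y_def inner_simps inner_commute algebra_simps)
    also have "c * (u \<bullet> u) - u \<bullet> f u = 0" using uu by (simp add: c_def)
    finally show ?thesis by (simp add: algebra_simps)
  qed
  have "y \<bullet> y = 0"
  proof (rule ccontr)
    assume ne: "y \<bullet> y \<noteq> 0"
    define a b where "a = y \<bullet> y" and "b = c * (y \<bullet> y) - y \<bullet> f y"
    have a: "a > 0" using ne by (simp add: a_def)
    have b: "b \<ge> 0" using q[OF yS] by (simp add: b_def)
    \<comment> \<open>The step \<open>- t\<close> is small enough for the linear term to dominate;
      the denominator \<open>b + 1\<close> stays positive when \<open>b = 0\<close>.\<close>
    define t where "t = a / (b + 1)"
    have t: "t > 0" and at: "a = t * (b + 1)" using a b by (simp_all add: t_def)
    have "0 \<le> 2 * (- t) * a + (- t)\<^sup>2 * b"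
      using key[of "- t"] by (simp add: a_def b_def)
    also have "\<dots> = - (t * t * (b + 2))"
      by (simp add: at power2_eq_square algebra_simps)
    also have "\<dots> < 0" using t b by simp
    finally show False by simp
  qed
  hence "f u = c *\<^sub>R u" by (simp add: y_def)
  with uS un that show ?thesis by blast
qed

text \<open>Split off one eigenvector and recurse on its orthogonal complement in \<open>S\<close>,
  which is again invariant because \<open>f\<close> is self-adjoint. General invariant subspaces
  make the induction on the dimension possible.\<close>

lemma selfadjoint_orthonormal_eigenvectors:
  fixes f :: "'a::euclidean_space \<Rightarrow> 'a"
  assumes lin: "linear f" and sa: "\<And>x y. f x \<bullet> y = x \<bullet> f y"
  shows "subspace S \<Longrightarrow> f ` S \<subseteq> S \<Longrightarrow>
    \<exists>B\<subseteq>S. finite B \<and> card B = dim S \<and> pairwise orthogonal B \<and> (\<forall>b\<in>B. norm b = 1 \<and> (\<exists>c. f b = c *\<^sub>R b))"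
proof (induction "dim S" arbitrary: S)
  case 0
  show ?case using 0(1) by (intro exI[of _ "{}"]) simp
next
  case (Suc n)
  have "S \<noteq> {0}" using Suc.hyps(2) by auto
  then obtain u c where u: "u \<in> S" "norm u = 1" "f u = c *\<^sub>R u"
    by (rule selfadjoint_eigenvector_exists[OF lin sa Suc.prems])
  define T where "T = {y \<in> S. \<forall>x\<in>span {u}. orthogonal x y}"
  have T: "T = {y \<in> S. orthogonal u y}"
  proof -
    have "(\<forall>x\<in>span {u}. orthogonal x y) \<longleftrightarrow> orthogonal u y" for y
      using span_base[of u "{u}"] by (auto simp: span_singleton orthogonal_def)
    thus ?thesis by (simp add: T_def)
  qed
  have "dim T + dim (span {u}) = dim S"
    unfolding T_def using Suc.prems u(1)
    by (intro dim_subspace_orthogonal_to_vectors) (auto simp: span_minimal subspace_span)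
  moreover have "dim (span {u}) = 1" using u(2) by (auto simp: dim_singleton dim_span)
  ultimately have dT: "n = dim T" using Suc.hyps(2) by simp
  have sT: "subspace T" using Suc.prems(1)
    unfolding T subspace_def orthogonal_def by (auto simp: inner_simps)
  have "f ` T \<subseteq> T"
    using Suc.prems(2) sa[of u, symmetric] u(3) by (auto simp: T orthogonal_def)
  from Suc.hyps(1)[OF dT sT this] obtain B where B: "B \<subseteq> T" "finite B" "card B = dim T"
    "pairwise orthogonal B" "\<forall>b\<in>B. norm b = 1 \<and> (\<exists>c. f b = c *\<^sub>R b)" by blast
  have nB: "u \<notin> B" using B(1) u(2) by (auto simp: T orthogonal_def)
  show ?case
  proof (intro exI conjI)
    show "insert u B \<subseteq> S" using B(1) u(1) by (auto simp: T)
    show "finite (insert u B)" using B by simp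
    show "card (insert u B) = dim S" using nB B dT Suc.hyps(2) by simp
    show "pairwise orthogonal (insert u B)"
      using B(1,4) by (auto simp: pairwise_insert T) (auto simp: orthogonal_def inner_commute)
    show "\<forall>b\<in>insert u B. norm b = 1 \<and> (\<exists>c. f b = c *\<^sub>R b)" using B(5) u by blast
  qed
qed

definition diag :: "('n \<Rightarrow> real) \<Rightarrow> real^'n^'n" where
  "diag d = (\<chi> i j. if i = j then d i else 0)"

lemma symm_inner: "symm A \<Longrightarrow> (A *v x) \<bullet> y = x \<bullet> (A *v y)"
  by (metis dot_lmul_matrix symm_def transpose_matrix_vector)

lemma symmetric_diagonalization:
  fixes A :: "real^'n^'n"
  assumes "symm A"
  obtains U d where "orthogonal_matrix U" "A = U ** diag d ** transpose U"
proof -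
  obtain B where B: "finite B" "card B = CARD('n)" "pairwise orthogonal B"
     "\<forall>b\<in>B. norm b = 1 \<and> (\<exists>c. A *v b = c *\<^sub>R b)"
    using selfadjoint_orthonormal_eigenvectors[of "(*v) A" UNIV] symm_inner[OF assms]
    by (auto simp: matrix_vector_mul_linear)
  \<comment> \<open>Indexing the eigenbasis by the type \<open>'n\<close> makes its vectors the
    columns of a square matrix.\<close>
  obtain h :: "'n \<Rightarrow> real^'n" where h: "bij_betw h UNIV B"
    using B(1,2) finite_same_card_bij[of "UNIV :: 'n set" B] by auto
  have hB: "h i \<in> B" for i using h by (auto simp: bij_betw_def)
  have "\<forall>i. \<exists>c. A *v h i = c *\<^sub>R h i" using B(4) hB by blast
  hence "\<exists>d. \<forall>i. A *v h i = d i *\<^sub>R h i" by (rule choice)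
  then obtain d where d: "A *v h i = d i *\<^sub>R h i" for i by blast
  define U :: "real^'n^'n" where "U = (\<chi> a i. h i $ a)"
  have hh: "h i \<bullet> h j = (if i = j then 1 else 0)" for i j
  proof (cases "i = j")
    case False
    hence "h i \<noteq> h j" using h by (auto simp: bij_betw_def inj_on_def)
    thus ?thesis using B(3) hB False by (auto simp: pairwise_def orthogonal_def)
  qed (use B(4) hB in \<open>auto simp: norm_eq_1\<close>)
  have "transpose U ** U = mat 1"
    using hh by (simp add: vec_eq_iff matrix_matrix_mult_def U_def transpose_def mat_def inner_vec_def)
  hence oU: "orthogonal_matrix U" by (simp add: orthogonal_matrix)
  have "(A ** U) $ a $ i = (U ** diag d) $ a $ i" for a i
  proof -
    have "(A ** U) $ a $ i = (A *v h i) $ a"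
      by (simp add: matrix_matrix_mult_def matrix_vector_mult_def U_def)
    also have "\<dots> = (U ** diag d) $ a $ i"
      by (simp add: d matrix_matrix_mult_def U_def diag_def if_distrib[where f="\<lambda>x. _ * x"] mult.commute cong: if_cong)
    finally show ?thesis .
  qed
  hence "A ** U = U ** diag d" by (simp add: vec_eq_iff)
  hence "A ** (U ** transpose U) = U ** diag d ** transpose U" by (simp add: matrix_mul_assoc)
  moreover have "U ** transpose U = mat 1" using oU by (simp add: orthogonal_matrix_def)
  ultimately show ?thesis using that oU by simp
qed

subsection \<open>Positive semidefinite and block matrices\<close>

lemma symm_transpose: "symm A \<Longrightarrow> transpose A = A"
  by (simp add: symm_def)

lemma psd_symm: "psd A \<Longrightarrow> symm A"
  by (simp add: psd_def)

lemma psd_nonneg: "psd A \<Longrightarrow> 0 \<le> v \<bullet> (A *v v)"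
  by (simp add: psd_def)

lemma inner_matrix_vector_mult: "x \<bullet> (A *v y) = (transpose A *v x) \<bullet> (y :: real^'n)"
  by (simp add: dot_lmul_matrix)

lemma inner_diag: "v \<bullet> (diag d *v v) = (\<Sum>i\<in>UNIV. d i * (v $ i)\<^sup>2)"
proof -
  have "(diag d *v v) $ i = d i * v $ i" for i
    by (simp add: diag_def matrix_vector_mult_def if_distrib[where f="\<lambda>x. x * _"] cong: if_cong)
  thus ?thesis by (simp add: inner_vec_def power2_eq_square algebra_simps)
qed

lemma diag_mult: "diag c ** diag d = diag (\<lambda>i. c i * d i)"
  by (simp add: vec_eq_iff diag_def matrix_matrix_mult_def if_distrib[where f="\<lambda>x. x * _"] cong: if_cong)

lemma transpose_diag [simp]: "transpose (diag d) = diag d"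
  by (auto simp: vec_eq_iff diag_def transpose_def)

text \<open>For a fixed orthogonal \<open>U\<close> this is multiplicative in \<open>d\<close>, so
  square roots and pseudoinverses can be formed eigenvalue by eigenvalue.\<close>

definition spectral :: "real^'n^'n \<Rightarrow> ('n \<Rightarrow> real) \<Rightarrow> real^'n^'n" where
  "spectral U d = U ** diag d ** transpose U"

lemma symm_spectral: "symm (spectral U d)"
  by (simp add: symm_def spectral_def matrix_transpose_mul matrix_mul_assoc)

lemma spectral_mult:
  assumes "orthogonal_matrix U"
  shows "spectral U c ** spectral U d = spectral U (\<lambda>i. c i * d i)"
proof -
  have "spectral U c ** spectral U d = U ** diag c ** (transpose U ** U) ** diag d ** transpose U"
    by (simp only: spectral_def matrix_mul_assoc)
  also have "\<dots> = U ** (diag c ** diag d) ** transpose U"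
    using assms by (simp add: orthogonal_matrix matrix_mul_assoc)
  finally show ?thesis by (simp add: diag_mult spectral_def)
qed

lemma inner_spectral: "v \<bullet> (spectral U d *v v) = (\<Sum>i\<in>UNIV. d i * ((transpose U *v v) $ i)\<^sup>2)"
  unfolding inner_diag[symmetric] spectral_def
  by (simp add: matrix_vector_mul_assoc[symmetric] inner_matrix_vector_mult)

lemma psd_spectral: "(\<And>i. d i \<ge> 0) \<Longrightarrow> psd (spectral U d)"
  by (simp add: psd_def symm_spectral inner_spectral sum_nonneg)

text \<open>Each \<open>d i\<close> is the value of the quadratic form of \<open>A\<close> at the
  \<open>i\<close>-th column of \<open>U\<close>.\<close>

lemma psd_diagonalization:
  assumes "psd A"
  obtains U d where "orthogonal_matrix U" "A = spectral U d" "\<And>i. d i \<ge> 0"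
proof -
  obtain U d where U: "orthogonal_matrix U" "A = spectral U d"
    using symmetric_diagonalization[OF psd_symm[OF assms]] by (auto simp: spectral_def)
  have "d i \<ge> 0" for i
  proof -
    have "transpose U *v (U *v axis i 1) = axis i 1"
      using U(1) by (simp only: matrix_vector_mul_assoc orthogonal_matrix matrix_vector_mul_lid)
    hence "(U *v axis i 1) \<bullet> (A *v (U *v axis i 1)) = (\<Sum>j\<in>UNIV. d j * (axis i 1 $ j :: real)\<^sup>2)"
      by (simp only: inner_spectral U(2))
    also have "\<dots> = d i"
      by (simp add: axis_def if_distrib[where f="\<lambda>x. _ * x"] if_distrib[where f="\<lambda>x. x\<^sup>2"] cong: if_cong)
    finally show ?thesis using psd_nonneg[OF assms] by metis
  qed
  with that U show ?thesis by blast
qed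

section \<open>Square roots, pseudoinverses and projections\<close>

lemma psd_square_root_exists:
  assumes "psd A"
  shows "\<exists>S. psd S \<and> S ** S = A"
proof -
  obtain U d where "orthogonal_matrix U" "A = spectral U d" "\<And>i. d i \<ge> 0"
    using psd_diagonalization[OF assms] by blast
  thus ?thesis
    by (intro exI[of _ "spectral U (\<lambda>i. sqrt (d i))"]) (simp add: psd_spectral spectral_mult)
qed

lemma psd_square_root_unique:
  assumes S: "psd S" and T: "psd T" and eq: "S ** S = T ** T"
  shows "S = T"
proof -
  obtain U d where U: "orthogonal_matrix U" "S = spectral U d" "\<And>i. d i \<ge> 0"
    using psd_diagonalization[OF S] by blast
  \<comment> \<open>\<open>T\<close> agrees with \<open>S\<close> on its eigenvectors: \<open>(T + d)(T - d) b = 0\<close> and \<open>T + d\<close> is injective for \<open>d > 0\<close>.\<close>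
  have "T *v (U *v axis i 1) = S *v (U *v axis i 1)" for i
  proof -
    define b where "b = U *v axis i 1"
    have "transpose U *v b = axis i 1"
      using U(1) by (simp only: b_def matrix_vector_mul_assoc orthogonal_matrix matrix_vector_mul_lid)
    hence "S *v b = U *v (diag d *v axis i 1)"
      unfolding U(2) spectral_def by (simp only: matrix_vector_mul_assoc[symmetric])
    also have "diag d *v axis i 1 = d i *\<^sub>R axis i 1"
      by (simp add: vec_eq_iff diag_def matrix_vector_mult_def axis_def if_distrib[where f="\<lambda>x. _ * x"] cong: if_cong)
    finally have Sb: "S *v b = d i *\<^sub>R b" by (simp add: matrix_vector_mult_scaleR b_def)
    have TT: "T *v (T *v b) = d i *\<^sub>R (d i *\<^sub>R b)"
    proof -
      have "T *v (T *v b) = S *v (S *v b)" by (simp only: matrix_vector_mul_assoc eq)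
      thus ?thesis by (simp only: Sb matrix_vector_mult_scaleR)
    qed
    have "T *v b = d i *\<^sub>R b"
    proof (cases "d i = 0")
      case True
      \<comment> \<open>For a zero eigenvalue \<open>T + d\<close> may fail to be injective; here
        symmetry gives that the squared norm of \<open>T *v b\<close> is
        \<open>b \<bullet> (T *v (T *v b))\<close>, which is zero.\<close>
      hence "(T *v b) \<bullet> (T *v b) = 0" using symm_inner[OF psd_symm[OF T], of b "T *v b"] TT by simp
      thus ?thesis using True by simp
    next
      case False
      define w where "w = T *v b - d i *\<^sub>R b"
      have "T *v w + d i *\<^sub>R w = 0"
        by (simp add: w_def matrix_vector_mult_diff_distrib matrix_vector_mult_scaleR TT scaleR_diff_right)
      hence "w \<bullet> (T *v w) + d i * (w \<bullet> w) = 0"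
        by (metis inner_add_right inner_scaleR_right inner_zero_right)
      moreover have "d i > 0" using U(3)[of i] False by simp
      ultimately have "w \<bullet> w \<le> 0"
        using psd_nonneg[OF T, of w] by (smt (verit) mult_pos_pos)
      hence "w = 0" using inner_ge_zero[of w] by (simp add: order_antisym)
      thus ?thesis by (simp add: w_def)
    qed
    with Sb show ?thesis by (simp add: b_def)
  qed
  hence "column i (T ** U) = column i (S ** U)" for i
    by (simp only: matrix_vector_mult_basis[symmetric] matrix_vector_mul_assoc[symmetric])
  hence "T ** U = S ** U" by (simp add: vec_eq_iff column_def)
  hence "T ** (U ** transpose U) = S ** (U ** transpose U)" by (simp add: matrix_mul_assoc)
  thus ?thesis using U(1) by (simp add: orthogonal_matrix_def)
qed

lemma msqrt:
  assumes "psd A"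
  shows "psd (msqrt A)" "msqrt A ** msqrt A = A"
proof -
  have "\<exists>!S. psd S \<and> S ** S = A"
    using psd_square_root_exists[OF assms] psd_square_root_unique by blast
  from theI'[OF this] show "psd (msqrt A)" "msqrt A ** msqrt A = A" by (simp_all add: msqrt_def)
qed

text \<open>The Moore-Penrose inverse: nonzero eigenvalues are inverted, and
  \<open>inverse 0 = 0\<close> leaves the kernel alone. It stands in for the inverse of matrices
  that may be singular.\<close>

lemma psd_pseudoinverse:
  assumes "psd B"
  obtains R where "symm R" "B ** R ** B = B" "R ** B ** R = R" "B ** R = R ** B"
proof -
  obtain U d where U: "orthogonal_matrix U" "B = spectral U d"
    using psd_diagonalization[OF assms] by blast
  have "(\<lambda>i. d i * inverse (d i) * d i) = d" "(\<lambda>i. inverse (d i) * d i * inverse (d i)) = (\<lambda>i. inverse (d i))"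
  proof -
    have "d i * inverse (d i) * d i = d i" "inverse (d i) * d i * inverse (d i) = inverse (d i)" for i
      by (cases "d i = 0"; simp)+
    thus "(\<lambda>i. d i * inverse (d i) * d i) = d" "(\<lambda>i. inverse (d i) * d i * inverse (d i)) = (\<lambda>i. inverse (d i))"
      by (simp_all only:)
  qed
  with U show ?thesis
    by (intro that[of "spectral U (\<lambda>i. inverse (d i))"]) (simp_all add: spectral_mult symm_spectral mult.commute)
qed

lemma psd_congruence:
  assumes "psd A"
  shows "psd (transpose B ** A ** B)"
proof -
  have "symm (transpose B ** A ** B)"
    using psd_symm[OF assms] by (simp add: symm_def matrix_transpose_mul matrix_mul_assoc)
  moreover have "v \<bullet> ((transpose B ** A ** B) *v v) = (B *v v) \<bullet> (A *v (B *v v))" for v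
    by (simp add: matrix_vector_mul_assoc[symmetric] inner_matrix_vector_mult del: transpose_matrix_vector)
  ultimately show ?thesis using psd_nonneg[OF assms] by (simp add: psd_def)
qed

text \<open>The difference of the two sides is the squared norm of
  \<open>v - P *v v\<close>.\<close>

lemma psd_inner_orthogonal_projection:
  assumes P: "symm P" "P ** P = P"
  shows "v \<bullet> (P *v v) \<le> v \<bullet> v"
proof -
  have e: "v \<bullet> (P *v v) = (P *v v) \<bullet> (P *v v)"
    using symm_inner[OF P(1), of v "P *v v"] P(2) by (simp add: matrix_vector_mul_assoc)
  have "0 \<le> (v - P *v v) \<bullet> (v - P *v v)" by simp
  also have "\<dots> = v \<bullet> v - v \<bullet> (P *v v)"
    using e by (simp add: inner_simps inner_commute)
  finally show ?thesis by simp
qed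

section \<open>Block matrices as quadratic forms\<close>

lemma sum_UNIV_Plus: "(\<Sum>i\<in>(UNIV :: ('a::finite + 'b::finite) set). f i) = (\<Sum>a\<in>UNIV. f (Inl a)) + (\<Sum>b\<in>UNIV. f (Inr b))"
  by (subst UNIV_Plus_UNIV[symmetric]) (simp only: sum.Plus finite o_def)

definition vjoin :: "real^'n \<Rightarrow> real^'m \<Rightarrow> real^('n + 'm)" where
  "vjoin v w = (\<chi> i. case i of Inl a \<Rightarrow> v $ a | Inr b \<Rightarrow> w $ b)"

lemma inner_blockmat:
  "vjoin v w \<bullet> (blockmat A B C D *v vjoin v w) = v \<bullet> (A *v v) + v \<bullet> (B *v w) + w \<bullet> (C *v v) + w \<bullet> (D *v w)"
  by (simp add: inner_vec_def matrix_vector_mult_def sum_UNIV_Plus blockmat_def vjoin_def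
      sum.distrib distrib_left)

lemma vjoin_surj: "\<exists>v w. u = vjoin v w"
  by (intro exI[of _ "\<chi> i. u $ Inl i"] exI[of _ "\<chi> i. u $ Inr i"])
    (auto simp: vec_eq_iff vjoin_def split: sum.splits)

lemma psd_blockmat_iff:
  "psd (blockmat A C (transpose C) D) \<longleftrightarrow>
    symm A \<and> symm D \<and> (\<forall>v w. 0 \<le> v \<bullet> (A *v v) + 2 * (v \<bullet> (C *v w)) + w \<bullet> (D *v w))"
proof -
  have "symm (blockmat A C (transpose C) D) \<longleftrightarrow> symm A \<and> symm D"
    unfolding symm_def vec_eq_iff transpose_def blockmat_def
    by (force split: sum.splits)
  moreover have "(\<forall>u. 0 \<le> u \<bullet> (blockmat A C (transpose C) D *v u)) \<longleftrightarrow>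
     (\<forall>v w. 0 \<le> vjoin v w \<bullet> (blockmat A C (transpose C) D *v vjoin v w))"
    by (metis vjoin_surj)
  moreover have "v \<bullet> (C *v w) + w \<bullet> (transpose C *v v) = 2 * (v \<bullet> (C *v w))" for v w
    by (simp add: inner_matrix_vector_mult inner_commute)
  ultimately show ?thesis by (simp add: psd_def inner_blockmat add.assoc[of "v \<bullet> (A *v v)" for v])
qed

lemma psd_bmat_iff:
  "psd (bmat Z z l) \<longleftrightarrow> symm Z \<and> (\<forall>v t. 0 \<le> v \<bullet> (Z *v v) + 2 * t * (z \<bullet> v) + l * t\<^sup>2)"
proof -
  have "rowv z = transpose (colv z)" by (simp add: rowv_def colv_def transpose_def vec_eq_iff)
  moreover have "symm (scal l)" by (simp add: symm_def scal_def transpose_def vec_eq_iff)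
  moreover have "v \<bullet> (colv z *v w) = w $ () * (z \<bullet> v)" for v and w :: "real^unit"
    by (simp add: inner_vec_def colv_def matrix_vector_mult_def UNIV_unit sum_distrib_left algebra_simps)
  moreover have "w \<bullet> (scal l *v w) = l * (w $ ())\<^sup>2" for w :: "real^unit"
    by (simp add: inner_vec_def scal_def matrix_vector_mult_def power2_eq_square UNIV_unit)
  \<comment> \<open>A vector indexed by \<open>unit\<close> is just a real number
    \<open>t\<close>.\<close>
  moreover have "(\<forall>w :: real^unit. P (w $ ())) \<longleftrightarrow> (\<forall>t. P t)" for P
  proof
    assume P: "\<forall>w :: real^unit. P (w $ ())"
    show "\<forall>t. P t" using P[THEN spec[of _ "\<chi> i. t" for t]] by simp
  qed simp
  from this[of "\<lambda>t. 0 \<le> v \<bullet> (Z *v v) + 2 * (t * (z \<bullet> v)) + l * t\<^sup>2" for v]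
  have "(\<forall>v (w :: real^unit). 0 \<le> v \<bullet> (Z *v v) + 2 * (w $ () * (z \<bullet> v)) + l * (w $ ())\<^sup>2)
      \<longleftrightarrow> (\<forall>v t. 0 \<le> v \<bullet> (Z *v v) + 2 * (t * (z \<bullet> v)) + l * t\<^sup>2)"
    by (simp only:)
  ultimately show ?thesis by (simp add: bmat_def psd_blockmat_iff mult.assoc)
qed

subsection \<open>Optimal couplings and the Gelbrich distance\<close>

lemma inner_axis_matrix: "axis k 1 \<bullet> (X *v axis k 1) = X $ k $ (k :: 'n)"
  for X :: "real^'n^'n"
  by (simp add: inner_axis' matrix_vector_mult_basis column_def)

lemma trace_orthogonal:
  fixes A :: "real^'n^'n"
  assumes "orthogonal_matrix U"
  shows "trace A = (\<Sum>k\<in>UNIV. (U *v axis k 1) \<bullet> (A *v (U *v axis k 1)))"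
proof -
  have "trace A = trace ((A ** U) ** transpose U)"
    using assms by (simp add: matrix_mul_assoc[symmetric] orthogonal_matrix_def)
  also have "\<dots> = trace (transpose U ** (A ** U))" by (rule trace_mul_sym)
  also have "\<dots> = (\<Sum>k\<in>UNIV. axis k 1 \<bullet> ((transpose U ** (A ** U)) *v axis k 1))"
    by (simp add: trace_def inner_axis_matrix)
  also have "\<dots> = (\<Sum>k\<in>UNIV. (U *v axis k 1) \<bullet> (A *v (U *v axis k 1)))"
    by (simp add: matrix_vector_mul_assoc[symmetric] inner_matrix_vector_mult del: transpose_matrix_vector)
  finally show ?thesis .
qed

text \<open>Both traces are computed in an eigenbasis of \<open>P\<close>. For a unit eigenvector
  \<open>b\<close>, Cauchy-Schwarz bounds \<open>b \<bullet> (N *v b)\<close> by the norm of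
  \<open>transpose N *v b\<close>, hence by the norm of \<open>P *v b\<close>, which is the
  eigenvalue \<open>b \<bullet> (P *v b)\<close>.\<close>

lemma trace_le_trace_psd:
  fixes N P :: "real^'n^'n"
  assumes P: "psd P"
    and le: "\<And>v. (transpose N *v v) \<bullet> (transpose N *v v) \<le> (P *v v) \<bullet> (P *v v)"
  shows "trace N \<le> trace P"
proof -
  obtain U d where U: "orthogonal_matrix U" "P = spectral U d" "\<And>i. d i \<ge> 0"
    using psd_diagonalization[OF P] by blast
  have "(U *v axis k 1) \<bullet> (N *v (U *v axis k 1)) \<le> (U *v axis k 1) \<bullet> (P *v (U *v axis k 1))" for k
  proof -
    define b where "b = U *v axis k 1"
    have nb: "b \<bullet> b = 1"
      using orthogonal_transformation_matrix[of "(*v) U"] U(1)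
      by (simp add: b_def orthogonal_transformation_def inner_axis_axis)
    have "transpose U *v b = axis k 1"
      using U(1) by (simp only: b_def matrix_vector_mul_assoc orthogonal_matrix matrix_vector_mul_lid)
    hence "P *v b = U *v (diag d *v axis k 1)"
      unfolding U(2) spectral_def by (simp only: matrix_vector_mul_assoc[symmetric])
    also have "diag d *v axis k 1 = d k *\<^sub>R axis k 1"
      by (simp add: vec_eq_iff diag_def matrix_vector_mult_def axis_def if_distrib[where f="\<lambda>x. _ * x"] cong: if_cong)
    finally have Pb: "P *v b = d k *\<^sub>R b" by (simp add: matrix_vector_mult_scaleR b_def)
    have "b \<bullet> (N *v b) = (transpose N *v b) \<bullet> b" by (rule inner_matrix_vector_mult)
    also have "\<dots> \<le> norm (transpose N *v b) * norm b" by (rule norm_cauchy_schwarz)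
    also have "\<dots> \<le> norm (P *v b) * norm b"
      using le[of b] by (intro mult_right_mono) (auto simp: norm_le)
    also have "\<dots> = d k" using nb[folded norm_eq_1] U(3)[of k] by (simp add: Pb)
    also have "\<dots> = b \<bullet> (P *v b)" by (simp add: Pb nb)
    finally show ?thesis by (simp add: b_def)
  qed
  thus ?thesis unfolding trace_orthogonal[OF U(1)] by (rule sum_mono)
qed

lemma psd_sandwich:
  assumes "psd S" "psd B"
  shows "psd (B ** S ** B)"
  using psd_congruence[OF assms(1), of B] psd_symm[OF assms(2)] by (simp add: symm_def)

lemma inner_symm_symm:
  assumes "symm A" "symm B" shows "(A *v x) \<bullet> (B *v y) = x \<bullet> ((A ** B) *v y)"
  by (simp add: symm_inner[OF assms(1)] matrix_vector_mul_assoc)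

text \<open>With \<open>B\<close> the root of \<open>\<Sigma>h\<close>, the block constraint forces
  \<open>C = K ** B\<close> with \<open>K ** transpose K\<close> at most \<open>\<Sigma>\<close> in
  the Loewner order. Then \<open>trace C = trace (B ** K)\<close>, and \<open>B ** K\<close> times
  its transpose is at most \<open>B ** \<Sigma> ** B = P ** P\<close>.\<close>

lemma trace_coupling_le:
  fixes \<Sigma> \<Sigma>h C :: "real^'n^'n"
  assumes \<Sigma>: "psd \<Sigma>" and \<Sigma>h: "psd \<Sigma>h"
    and block: "psd (blockmat \<Sigma> C (transpose C) \<Sigma>h)"
  shows "trace C \<le> trace (msqrt (msqrt \<Sigma>h ** \<Sigma> ** msqrt \<Sigma>h))"
proof -
  define B where "B = msqrt \<Sigma>h"
  have B: "psd B" "B ** B = \<Sigma>h" using msqrt[OF \<Sigma>h] by (simp_all add: B_def)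
  note sB = psd_symm[OF B(1)]
  define P where "P = msqrt (B ** \<Sigma> ** B)"
  have P: "psd P" "P ** P = B ** \<Sigma> ** B"
    using msqrt[OF psd_sandwich[OF \<Sigma> B(1)]] by (simp_all add: P_def)
  obtain R where R: "symm R" "B ** R ** B = B" "R ** B ** R = R" "B ** R = R ** B"
    using psd_pseudoinverse[OF B(1)] by blast
  have q: "0 \<le> v \<bullet> (\<Sigma> *v v) + 2 * (v \<bullet> (C *v w)) + (B *v w) \<bullet> (B *v w)" for v w
    using block by (simp add: psd_blockmat_iff inner_symm_symm[OF sB sB] B(2))
  \<comment> \<open>\<open>B ** R\<close> is the orthogonal projection onto the range of
    \<open>B\<close>.\<close>
  have sP: "symm (B ** R)"
    using sB R(1,4) by (simp add: symm_def matrix_transpose_mul)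
  have iP: "(B ** R) ** (B ** R) = B ** R"
    using R(2) by (simp add: matrix_mul_assoc)
  \<comment> \<open>Along the kernel of \<open>B\<close> the block form is affine in the scaling of
    \<open>w\<close>, so it stays nonnegative only if the mixed term vanishes. The value of
    \<open>t\<close> chosen below would make it \<open>- 1\<close>.\<close>
  have kernel: "C *v w = 0" if "B *v w = 0" for w
  proof -
    define u where "u = C *v w"
    have "0 \<le> u \<bullet> (\<Sigma> *v u) - 2 * t * (u \<bullet> u)" for t :: real
      using q[of u "(- t) *\<^sub>R w"] that by (simp add: matrix_vector_mult_scaleR u_def del: scaleR_minus_left)
    from this[of "(u \<bullet> (\<Sigma> *v u) + 1) / (2 * (u \<bullet> u))"] have "u \<bullet> u = 0"
      by (cases "u = 0") auto
    thus ?thesis by (simp add: u_def)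
  qed
  have CRB: "C ** R ** B = C"
  proof -
    have "B *v (v - R *v (B *v v)) = 0" for v
      by (simp add: matrix_vector_mult_diff_distrib matrix_vector_mul_assoc R(2) matrix_mul_assoc)
    hence "C *v (v - R *v (B *v v)) = 0" for v by (rule kernel)
    hence "C *v v = (C ** R ** B) *v v" for v
      by (simp add: matrix_vector_mult_diff_distrib matrix_vector_mul_assoc matrix_mul_assoc)
    thus ?thesis by (simp add: matrix_eq)
  qed
  define K where "K = C ** R"
  have KS: "(transpose K *v v) \<bullet> (transpose K *v v) \<le> v \<bullet> (\<Sigma> *v v)" for v
  proof -
    define y where "y = transpose K *v v"
    have y: "y = R *v (transpose C *v v)"
      by (simp only: y_def K_def matrix_transpose_mul symm_transpose[OF R(1)] matrix_vector_mul_assoc)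
    have "v \<bullet> (C *v (R *v y)) = y \<bullet> y"
      using inner_matrix_vector_mult[of v K y, folded y_def] by (simp only: K_def matrix_vector_mul_assoc)
    moreover have "(B *v (R *v y)) \<bullet> (B *v (R *v y)) \<le> y \<bullet> y"
    proof -
      have "(B *v (R *v y)) \<bullet> (B *v (R *v y)) = y \<bullet> ((B ** R) *v y)"
        by (simp only: matrix_vector_mul_assoc inner_symm_symm[OF sP sP] iP)
      thus ?thesis using psd_inner_orthogonal_projection[OF sP iP] by simp
    qed
    \<comment> \<open>Testing the block form at \<open>w = - (R *v y)\<close> makes the mixed term
      \<open>- 2 * (y \<bullet> y)\<close>, while the quadratic term in \<open>w\<close> is at most
      \<open>y \<bullet> y\<close>.\<close>
    ultimately have "0 \<le> v \<bullet> (\<Sigma> *v v) - y \<bullet> y"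
      using q[of v "- (R *v y)"] by (simp add: linear_neg[OF matrix_vector_mul_linear])
    thus ?thesis by (simp add: y_def)
  qed
  have "trace C = trace (B ** K)"
    using CRB by (simp add: K_def trace_mul_sym[of B])
  also have "\<dots> \<le> trace P"
  proof (rule trace_le_trace_psd[OF P(1)])
    fix v
    have "transpose (B ** K) *v v = transpose K *v (B *v v)"
      by (simp only: matrix_transpose_mul symm_transpose[OF sB] matrix_vector_mul_assoc)
    hence "(transpose (B ** K) *v v) \<bullet> (transpose (B ** K) *v v) \<le> (B *v v) \<bullet> (\<Sigma> *v (B *v v))"
      by (simp only: KS)
    also have "\<dots> = (P *v v) \<bullet> (P *v v)"
      by (simp only: inner_symm_symm[OF psd_symm[OF P(1)] psd_symm[OF P(1)]] P(2) symm_inner[OF sB]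
          matrix_vector_mul_assoc matrix_mul_assoc)
    finally show "(transpose (B ** K) *v v) \<bullet> (transpose (B ** K) *v v) \<le> (P *v v) \<bullet> (P *v v)" .
  qed
  finally show ?thesis by (simp add: P_def B_def)
qed

text \<open>In the nonsingular case \<open>B ** R ** B\<close> is the optimal transport map between
  centred Gaussians with covariances \<open>\<Sigma>\<close> and \<open>\<Sigma>h\<close>, and
  \<open>C\<close> is the resulting cross-covariance. In general, with \<open>u\<close> the image of
  \<open>w\<close> under this map, the block form dominates the square
  \<open>(v + u) \<bullet> (\<Sigma> *v (v + u))\<close>. Cyclicity turns the trace of
  \<open>C\<close> into that of \<open>P ** P ** R\<close>, and this product is
  \<open>P\<close>.\<close>

lemma optimal_coupling_exists:
  fixes \<Sigma> \<Sigma>h :: "real^'n^'n"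
  assumes \<Sigma>: "psd \<Sigma>" and \<Sigma>h: "psd \<Sigma>h"
  obtains C where "psd (blockmat \<Sigma> C (transpose C) \<Sigma>h)"
    "trace C = trace (msqrt (msqrt \<Sigma>h ** \<Sigma> ** msqrt \<Sigma>h))"
proof -
  define B where "B = msqrt \<Sigma>h"
  have B: "psd B" "B ** B = \<Sigma>h" using msqrt[OF \<Sigma>h] by (simp_all add: B_def)
  note sB = psd_symm[OF B(1)]
  define P where "P = msqrt (B ** \<Sigma> ** B)"
  have P: "psd P" "P ** P = B ** \<Sigma> ** B"
    using msqrt[OF psd_sandwich[OF \<Sigma> B(1)]] by (simp_all add: P_def)
  note sP = psd_symm[OF P(1)]
  obtain R where R: "symm R" "P ** R ** P = P" "R ** P ** R = R" "P ** R = R ** P"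
    using psd_pseudoinverse[OF P(1)] by blast
  define C where "C = \<Sigma> ** B ** R ** B"
  have sPR: "symm (P ** R)"
    using sP R(1,4) by (simp add: symm_def matrix_transpose_mul)
  have iPR: "(P ** R) ** (P ** R) = P ** R"
    using R(2) by (simp add: matrix_mul_assoc)
  have "0 \<le> v \<bullet> (\<Sigma> *v v) + 2 * (v \<bullet> (C *v w)) + w \<bullet> (\<Sigma>h *v w)" for v w
  proof -
    define y where "y = B *v w"
    define u where "u = B *v (R *v y)"
    have "u \<bullet> (\<Sigma> *v u) = y \<bullet> ((P ** R) *v y)"
    proof -
      have "u \<bullet> (\<Sigma> *v u) = y \<bullet> ((R ** (B ** \<Sigma> ** B) ** R) *v y)"
        unfolding u_def symm_inner[OF sB] symm_inner[OF R(1)]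
        by (simp only: matrix_vector_mul_assoc matrix_mul_assoc)
      also have "R ** (B ** \<Sigma> ** B) ** R = P ** R"
        by (metis P(2) R(2) R(4) matrix_mul_assoc)
      finally show ?thesis .
    qed
    also have "\<dots> \<le> y \<bullet> y" by (rule psd_inner_orthogonal_projection[OF sPR iPR])
    also have "\<dots> = w \<bullet> (\<Sigma>h *v w)" by (simp only: y_def inner_symm_symm[OF sB sB] B(2))
    finally have 1: "u \<bullet> (\<Sigma> *v u) \<le> w \<bullet> (\<Sigma>h *v w)" .
    have 2: "v \<bullet> (C *v w) = v \<bullet> (\<Sigma> *v u)"
      by (simp only: C_def u_def y_def matrix_vector_mul_assoc matrix_mul_assoc)
    have 3: "u \<bullet> (\<Sigma> *v v) = v \<bullet> (\<Sigma> *v u)"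
      using symm_inner[OF psd_symm[OF \<Sigma>], of v u] by (simp add: inner_commute)
    have "0 \<le> (v + u) \<bullet> (\<Sigma> *v (v + u))" by (rule psd_nonneg[OF \<Sigma>])
    also have "\<dots> = v \<bullet> (\<Sigma> *v v) + 2 * (v \<bullet> (C *v w)) + u \<bullet> (\<Sigma> *v u)"
      by (simp add: 2 3 matrix_vector_right_distrib inner_simps)
    finally show ?thesis using 1 by linarith
  qed
  hence "psd (blockmat \<Sigma> C (transpose C) \<Sigma>h)"
    using \<Sigma> \<Sigma>h by (simp add: psd_blockmat_iff psd_symm)
  moreover have "trace C = trace P"
  proof -
    have "trace C = trace (B ** (\<Sigma> ** B ** R))" by (simp add: C_def trace_mul_sym[of B])
    also have "B ** (\<Sigma> ** B ** R) = P ** (P ** R)"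
      by (simp only: matrix_mul_assoc P(2))
    also have "\<dots> = P ** (R ** P)" by (simp only: R(4))
    also have "\<dots> = P" by (simp only: matrix_mul_assoc R(2))
    finally show ?thesis .
  qed
  ultimately show ?thesis using that by (simp add: P_def B_def)
qed

text \<open>\<open>sqrt\<close> is increasing on all of the reals, so squaring the bound also covers
  a negative radicand.\<close>

lemma gelbrich_le_iff:
  assumes "\<rho> \<ge> 0"
  shows "gelbrich (\<mu>, \<Sigma>) (\<mu>h, \<Sigma>h) \<le> \<rho> \<longleftrightarrow>
    (norm (\<mu> - \<mu>h))\<^sup>2 + trace \<Sigma> + trace \<Sigma>h - 2 * trace (msqrt (msqrt \<Sigma>h ** \<Sigma> ** msqrt \<Sigma>h)) \<le> \<rho>\<^sup>2"
proof -
  have "trace (a *\<^sub>R A) = a * trace A" for a and A :: "real^'a^'a"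
    by (simp add: trace_def sum_distrib_left)
  moreover have "sqrt e \<le> \<rho> \<longleftrightarrow> e \<le> \<rho>\<^sup>2" for e
    by (metis abs_of_nonneg assms real_sqrt_abs real_sqrt_le_iff)
  ultimately show ?thesis by (simp add: gelbrich_def trace_add trace_sub algebra_simps)
qed

subsection \<open>Truncated moments\<close>

lemma bmat_diff: "bmat A a \<alpha> - bmat B b \<beta> = bmat (A - B) (a - b) (\<alpha> - \<beta>)"
  by (simp add: vec_eq_iff bmat_def blockmat_def colv_def rowv_def scal_def split: sum.splits)

lemma bmat_sum: "(\<Sum>j\<in>I. bmat (Z j) (z j) (l j)) = bmat (\<Sum>j\<in>I. Z j) (\<Sum>j\<in>I. z j) (\<Sum>j\<in>I. l j)"
  by (simp add: vec_eq_iff bmat_def blockmat_def colv_def rowv_def scal_def split: sum.splits)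

lemma symm_add: "symm A \<Longrightarrow> symm B \<Longrightarrow> symm (A + B)"
  and symm_diff: "symm A \<Longrightarrow> symm B \<Longrightarrow> symm (A - B)"
  and symm_scaleR: "symm A \<Longrightarrow> symm (c *\<^sub>R A)"
  by (simp_all add: symm_def transpose_def vec_eq_iff)

lemma symm_sum: "(\<And>j. j \<in> I \<Longrightarrow> symm (Z j)) \<Longrightarrow> symm (\<Sum>j\<in>I. Z j)"
  by (simp add: symm_def transpose_def vec_eq_iff)

lemma inner_sum_matrix: "v \<bullet> ((\<Sum>j\<in>I. Z j) *v v) = (\<Sum>j\<in>I. v \<bullet> (Z j *v v))" for v :: "real^'n"
  by (induction I rule: infinite_finite_induct) (simp_all add: matrix_vector_mult_add_rdistrib inner_add_right)

lemma psd_add: "psd A \<Longrightarrow> psd B \<Longrightarrow> psd (A + B)"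
  by (simp add: psd_def symm_add matrix_vector_mult_add_rdistrib inner_add_right)

lemma psd_scaleR: "0 \<le> c \<Longrightarrow> psd A \<Longrightarrow> psd (c *\<^sub>R A)"
  by (simp add: psd_def symm_scaleR scaleR_matrix_vector_assoc[symmetric])

lemma psd_sum: "(\<And>j. j \<in> I \<Longrightarrow> psd (A j)) \<Longrightarrow> psd (\<Sum>j\<in>I. A j)"
  unfolding psd_def by (auto simp: inner_sum_matrix intro!: symm_sum sum_nonneg)

definition outer :: "real^'n \<Rightarrow> real^'n^'n" where
  "outer z = (\<chi> i j. z $ i * z $ j)"

lemma symm_outer: "symm (outer z)"
  by (simp add: symm_def outer_def transpose_def vec_eq_iff)

lemma outer_nth: "outer z $ i $ j = z $ i * z $ j"
  by (simp add: outer_def)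

lemma inner_outer: "v \<bullet> (outer z *v v) = (z \<bullet> v)\<^sup>2"
  by (simp add: inner_vec_def outer_def matrix_vector_mult_def power2_eq_square sum_product
      sum_distrib_left algebra_simps)

lemma trace_outer: "trace (outer z) = (norm z)\<^sup>2"
  by (simp add: trace_def outer_def power2_norm_eq_inner inner_vec_def)

lemma trace_scaleR: "trace (a *\<^sub>R A) = a * trace A" for A :: "real^'n^'n"
  by (simp add: trace_def sum_distrib_left)

text \<open>Passes from covariances to raw second moments, which are linear in the measure and
  correspond to the variable \<open>M\<close> of the program.\<close>

lemma has_mean_cov_iff:
  assumes "prob_space Q"
  shows "has_mean_cov Q \<mu> \<Sigma> \<longleftrightarrow>
     (\<forall>i. integrable Q (\<lambda>\<theta>. \<theta> $ i)) \<and> (\<forall>i k. integrable Q (\<lambda>\<theta>. \<theta> $ i * \<theta> $ k)) \<and>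
     (\<forall>i. (\<integral>\<theta>. \<theta> $ i \<partial>Q) = \<mu> $ i) \<and> (\<forall>i k. (\<integral>\<theta>. \<theta> $ i * \<theta> $ k \<partial>Q) = (\<Sigma> + outer \<mu>) $ i $ k)"
proof -
  interpret prob_space Q by fact
  have "(\<integral>\<theta>. (\<theta> $ i - \<mu> $ i) * (\<theta> $ k - \<mu> $ k) \<partial>Q) = (\<integral>\<theta>. \<theta> $ i * \<theta> $ k \<partial>Q) - \<mu> $ i * \<mu> $ k"
    if 1: "\<And>i. integrable Q (\<lambda>\<theta>. \<theta> $ i)" and 2: "\<And>i k. integrable Q (\<lambda>\<theta>. \<theta> $ i * \<theta> $ k)"
      and m: "\<And>i. (\<integral>\<theta>. \<theta> $ i \<partial>Q) = \<mu> $ i" for i k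
  proof -
    have "(\<integral>\<theta>. (\<theta> $ i - \<mu> $ i) * (\<theta> $ k - \<mu> $ k) \<partial>Q)
        = (\<integral>\<theta>. \<theta> $ i * \<theta> $ k - \<mu> $ k * \<theta> $ i - \<mu> $ i * \<theta> $ k + \<mu> $ i * \<mu> $ k \<partial>Q)"
      by (simp add: algebra_simps)
    also have "\<dots> = (\<integral>\<theta>. \<theta> $ i * \<theta> $ k \<partial>Q) - \<mu> $ k * \<mu> $ i - \<mu> $ i * \<mu> $ k + \<mu> $ i * \<mu> $ k"
      using 1 2 by (simp add: m prob_space)
    finally show ?thesis by simp
  qed
  note cov = this
  show ?thesis
  \<comment> \<open>The moment identity \<open>cov\<close> needs these conditions; if they fail,
    both sides are false.\<close>
  proof (cases "(\<forall>i. integrable Q (\<lambda>\<theta>. \<theta> $ i)) \<and> (\<forall>i k. integrable Q (\<lambda>\<theta>. \<theta> $ i * \<theta> $ k)) \<and>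
     (\<forall>i. (\<integral>\<theta>. \<theta> $ i \<partial>Q) = \<mu> $ i)")
    case True
    thus ?thesis by (simp add: has_mean_cov_def cov outer_nth diff_eq_eq)
  qed (auto simp: has_mean_cov_def)
qed

lemma Theta_int_sets: "Theta_int J x \<in> sets borel"
proof -
  have "open (\<Inter>j\<in>{1..J}. {\<theta>. x j \<bullet> \<theta> > 0})"
    by (intro open_INT ballI open_Collect_less continuous_intros; simp)
  moreover have "(\<Inter>j\<in>{1..J}. {\<theta>. x j \<bullet> \<theta> > 0}) = Theta_int J x" by (auto simp: Theta_int_def)
  ultimately show ?thesis by simp
qed

lemma Theta_sets: "Theta J x \<in> sets borel"
proof -
  have "closed (\<Inter>j\<in>{1..J}. {\<theta>. x j \<bullet> \<theta> \<ge> 0})"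
    by (intro closed_INT ballI closed_Collect_le continuous_intros; simp)
  moreover have "(\<Inter>j\<in>{1..J}. {\<theta>. x j \<bullet> \<theta> \<ge> 0}) = Theta J x" by (auto simp: Theta_def)
  ultimately show ?thesis by simp
qed

text \<open>Moments of the restriction of \<open>Q\<close> to \<open>S\<close>, not divided by its
  mass, so that they add up over disjoint sets.\<close>

definition mass :: "(real^'n) measure \<Rightarrow> (real^'n) set \<Rightarrow> real" where
  "mass Q S = (\<integral>\<theta>. indicator S \<theta> \<partial>Q)"
definition first_moment :: "(real^'n) measure \<Rightarrow> (real^'n) set \<Rightarrow> real^'n" where
  "first_moment Q S = (\<chi> i. \<integral>\<theta>. indicator S \<theta> * \<theta> $ i \<partial>Q)"
definition second_moment :: "(real^'n) measure \<Rightarrow> (real^'n) set \<Rightarrow> real^'n^'n" where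
  "second_moment Q S = (\<chi> i k. \<integral>\<theta>. indicator S \<theta> * (\<theta> $ i * \<theta> $ k) \<partial>Q)"

locale square_integrable_vector = prob_space Q for Q :: "(real^'n) measure" +
  assumes sets_eq [simp, measurable_cong]: "sets Q = sets borel"
    and int1: "\<And>i. integrable Q (\<lambda>\<theta>. \<theta> $ i)"
    and int2: "\<And>i k. integrable Q (\<lambda>\<theta>. \<theta> $ i * \<theta> $ k)"
begin

lemma int0_on: "S \<in> sets borel \<Longrightarrow> integrable Q (indicator S :: _ \<Rightarrow> real)"
  by (simp add: integrable_real_indicator emeasure_eq_measure)

lemma int1_on: "S \<in> sets borel \<Longrightarrow> integrable Q (\<lambda>\<theta>. indicator S \<theta> * \<theta> $ i)"
  using integrable_real_mult_indicator[OF _ int1, of S i] by (simp add: mult.commute)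

lemma int2_on: "S \<in> sets borel \<Longrightarrow> integrable Q (\<lambda>\<theta>. indicator S \<theta> * (\<theta> $ i * \<theta> $ k))"
  using integrable_real_mult_indicator[OF _ int2, of S i k] by (simp add: mult.commute)

text \<open>The quadratic form at \<open>(v, t)\<close> is the integral of
  \<open>(v \<bullet> \<theta> + t)\<^sup>2\<close> over \<open>S\<close>.\<close>

lemma psd_moments:
  assumes S: "S \<in> sets borel"
  shows "psd (bmat (second_moment Q S) (first_moment Q S) (mass Q S))"
proof -
  have "symm (second_moment Q S)"
    by (simp add: symm_def second_moment_def transpose_def vec_eq_iff mult.commute)
  moreover have "v \<bullet> (second_moment Q S *v v) + 2 * t * (first_moment Q S \<bullet> v) + mass Q S * t\<^sup>2
      = (\<integral>\<theta>. indicator S \<theta> * (v \<bullet> \<theta> + t)\<^sup>2 \<partial>Q)" for v t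
  proof -
    have "(\<integral>\<theta>. indicator S \<theta> * (v \<bullet> \<theta> + t)\<^sup>2 \<partial>Q) =
       (\<integral>\<theta>. (\<Sum>i\<in>UNIV. \<Sum>k\<in>UNIV. v $ i * v $ k * (indicator S \<theta> * (\<theta> $ i * \<theta> $ k)))
          + 2 * t * (\<Sum>i\<in>UNIV. v $ i * (indicator S \<theta> * \<theta> $ i)) + t\<^sup>2 * indicator S \<theta> \<partial>Q)"
      by (intro Bochner_Integration.integral_cong refl)
        (simp add: power2_sum inner_vec_def power2_eq_square sum_product sum_distrib_left sum_distrib_right algebra_simps)
    also have "\<dots> = (\<Sum>i\<in>UNIV. \<Sum>k\<in>UNIV. v $ i * v $ k * second_moment Q S $ i $ k)
          + 2 * t * (\<Sum>i\<in>UNIV. v $ i * first_moment Q S $ i) + t\<^sup>2 * mass Q S"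
      using S by (simp add: int0_on int1_on int2_on second_moment_def first_moment_def mass_def)
    also have "\<dots> = v \<bullet> (second_moment Q S *v v) + 2 * t * (first_moment Q S \<bullet> v) + mass Q S * t\<^sup>2"
      by (simp add: inner_vec_def matrix_vector_mult_def sum_distrib_left algebra_simps)
    finally show ?thesis by simp
  qed
  ultimately show ?thesis by (simp add: psd_bmat_iff)
qed

lemma inner_first_moment:
  assumes S: "S \<in> sets borel"
  shows "y \<bullet> first_moment Q S = (\<integral>\<theta>. indicator S \<theta> * (y \<bullet> \<theta>) \<partial>Q)"
proof -
  have "(\<integral>\<theta>. indicator S \<theta> * (y \<bullet> \<theta>) \<partial>Q) = (\<integral>\<theta>. (\<Sum>i\<in>UNIV. y $ i * (indicator S \<theta> * \<theta> $ i)) \<partial>Q)"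
    by (simp add: inner_vec_def sum_distrib_left algebra_simps)
  also have "\<dots> = y \<bullet> first_moment Q S"
    using S by (simp add: int1_on inner_vec_def first_moment_def)
  finally show ?thesis by simp
qed

lemma moments_sum:
  assumes I: "finite I" "\<And>j. j \<in> I \<Longrightarrow> A j \<in> sets borel"
    and ind: "\<And>\<theta>. indicator S \<theta> = (\<Sum>j\<in>I. indicator (A j) \<theta> :: real)"
  shows "second_moment Q S = (\<Sum>j\<in>I. second_moment Q (A j))"
    "first_moment Q S = (\<Sum>j\<in>I. first_moment Q (A j))"
    "mass Q S = (\<Sum>j\<in>I. mass Q (A j))"
proof -
  have "(\<integral>\<theta>. indicator S \<theta> * f \<theta> \<partial>Q) = (\<Sum>j\<in>I. \<integral>\<theta>. indicator (A j) \<theta> * f \<theta> \<partial>Q)"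
    if "\<And>j. j \<in> I \<Longrightarrow> integrable Q (\<lambda>\<theta>. indicator (A j) \<theta> * f \<theta>)" for f :: "real^'n \<Rightarrow> real"
    unfolding ind sum_distrib_right using that by (rule Bochner_Integration.integral_sum)
  note split = this
  show "second_moment Q S = (\<Sum>j\<in>I. second_moment Q (A j))"
    using I(2) by (simp add: vec_eq_iff second_moment_def split int2_on)
  show "first_moment Q S = (\<Sum>j\<in>I. first_moment Q (A j))"
    using I(2) by (simp add: vec_eq_iff first_moment_def split int1_on)
  show "mass Q S = (\<Sum>j\<in>I. mass Q (A j))"
    using split[of "\<lambda>_. 1"] I(2) by (simp add: mass_def int0_on)
qed

lemma moments_Compl:
  assumes S: "S \<in> sets borel"
  shows "second_moment Q UNIV - second_moment Q S = second_moment Q (- S)"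
    "first_moment Q UNIV - first_moment Q S = first_moment Q (- S)"
    "mass Q UNIV - mass Q S = mass Q (- S)"
proof -
  show "second_moment Q UNIV - second_moment Q S = second_moment Q (- S)"
    using S int2
    by (simp add: vec_eq_iff second_moment_def indicator_compl left_diff_distrib int2_on)
  show "first_moment Q UNIV - first_moment Q S = first_moment Q (- S)"
    using S int1
    by (simp add: vec_eq_iff first_moment_def indicator_compl left_diff_distrib int1_on)
  have "mass Q (- S) = (\<integral>\<theta>. 1 - indicator S \<theta> \<partial>Q)"
    unfolding mass_def by (intro Bochner_Integration.integral_cong refl) (simp add: indicator_compl)
  also have "\<dots> = (\<integral>\<theta>. 1 \<partial>Q) - mass Q S"
    unfolding mass_def using int0_on[OF S] by (intro Bochner_Integration.integral_diff) simp_all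
  finally show "mass Q UNIV - mass Q S = mass Q (- S)" by (simp add: mass_def)
qed

end

section \<open>From a measure in the ball to a feasible point\<close>

lemma gelbrich_ball_sdp_value:
  fixes x :: "nat \<Rightarrow> real^'n"
  assumes "\<rho> \<ge> 0" and \<Sigma>h: "psd \<Sigma>h" and Q: "Q \<in> gelbrich_ball \<mu>h \<Sigma>h \<rho>"
  shows "measure Q (Theta_int J x) \<in> sdp_values J x \<mu>h \<Sigma>h \<rho>"
proof -
  obtain \<mu> \<Sigma> where pQ: "prob_space Q" and sQ: "sets Q = sets borel" and \<Sigma>: "psd \<Sigma>"
    and g: "gelbrich (\<mu>, \<Sigma>) (\<mu>h, \<Sigma>h) \<le> \<rho>" and mc: "has_mean_cov Q \<mu> \<Sigma>"
    using Q by (auto simp: gelbrich_ball_def)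
  note mc = mc[unfolded has_mean_cov_iff[OF pQ]]
  interpret square_integrable_vector Q
    using pQ sQ mc by (simp add: square_integrable_vector_def square_integrable_vector_axioms_def)
  obtain C where C: "psd (blockmat \<Sigma> C (transpose C) \<Sigma>h)"
    "trace C = trace (msqrt (msqrt \<Sigma>h ** \<Sigma> ** msqrt \<Sigma>h))"
    using optimal_coupling_exists[OF \<Sigma> \<Sigma>h] by blast
  \<comment> \<open>\<open>A j\<close> holds the parameters whose first violated strict inequality
    is the \<open>j\<close>-th: \<open>Theta_int (j - 1) x\<close> imposes exactly the earlier
    ones.\<close>
  define A where "A j = {\<theta>. x j \<bullet> \<theta> \<le> 0} \<inter> Theta_int (j - 1) x" for j
  have sA: "A j \<in> sets borel" for j
    unfolding A_def by (intro sets.Int Theta_int_sets borel_closed closed_Collect_le continuous_intros)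
  have dA: "disjoint_family_on A {1..J}"
    unfolding disjoint_family_on_def
  proof (intro ballI impI)
    fix i j assume "i \<in> {1..J}" "j \<in> {1..J}" "i \<noteq> j"
    thus "A i \<inter> A j = {}"
      by (cases i j rule: linorder_cases) (force simp: A_def Theta_int_def)+
  qed
  have UA: "(\<Union>j\<in>{1..J}. A j) = - Theta_int J x"
  proof (induction J)
    case (Suc J)
    have "{1..Suc J} = insert (Suc J) {1..J}" by auto
    with Suc.IH show ?case by (auto simp: A_def Theta_int_def)
  qed (simp add: Theta_int_def)
  have ind: "indicator (- Theta_int J x) \<theta> = (\<Sum>j\<in>{1..J}. indicator (A j) \<theta> :: real)" for \<theta>
    unfolding UA[symmetric] by (rule indicator_UN_disjoint[OF _ dA]) simp
  note sums = moments_sum[OF finite_atLeastAtMost sA ind]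
  have U: "second_moment Q UNIV = \<Sigma> + outer \<mu>" "first_moment Q UNIV = \<mu>" "mass Q UNIV = 1"
    using mc prob_space by (simp_all add: second_moment_def first_moment_def mass_def vec_eq_iff)
  have com: "- (- Theta_int J x) = Theta_int J x" by simp
  have sC: "- Theta_int J x \<in> sets borel" by (intro borel_comp Theta_int_sets)
  note compl = moments_Compl[OF sC, unfolded sums U com]
  \<comment> \<open>The slack of this constraint is the moment matrix of \<open>Q\<close> on the
    open cone itself.\<close>
  have low: "loewner_le (\<Sum>j\<in>{1..J}. bmat (second_moment Q (A j)) (first_moment Q (A j)) (mass Q (A j)))
     (bmat (\<Sigma> + outer \<mu>) \<mu> 1)"
    unfolding loewner_le_def bmat_sum bmat_diff compl
    by (rule psd_moments[OF Theta_int_sets])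
  have val: "measure Q (Theta_int J x) = 1 - (\<Sum>j\<in>{1..J}. mass Q (A j))"
    unfolding compl
    using sets.sets_into_space[of "Theta_int J x" Q] sets_eq_imp_space_eq[OF sQ]
    by (simp add: mass_def)
  have 1: "psd (\<Sigma> + outer \<mu>)"
    using \<Sigma> by (simp add: psd_def symm_add symm_outer matrix_vector_mult_add_rdistrib inner_add_right inner_outer)
  \<comment> \<open>With \<open>M = \<Sigma> + outer \<mu>\<close> this block is the rank-one matrix
    of the vector \<open>(\<mu>, 1)\<close>.\<close>
  have 2: "psd (bmat (\<Sigma> + outer \<mu> - \<Sigma>) \<mu> 1)"
  proof -
    have "(\<mu> \<bullet> v)\<^sup>2 + 2 * t * (\<mu> \<bullet> v) + t\<^sup>2 = (\<mu> \<bullet> v + t)\<^sup>2" for v t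
      by (simp add: power2_sum)
    thus ?thesis by (simp add: psd_bmat_iff symm_outer inner_outer)
  qed
  have 3: "(norm \<mu>h)\<^sup>2 - 2 * (\<mu>h \<bullet> \<mu>) + trace (\<Sigma> + outer \<mu> + \<Sigma>h - 2 *\<^sub>R C) \<le> \<rho>\<^sup>2"
    using g[unfolded gelbrich_le_iff[OF \<open>\<rho> \<ge> 0\<close>] power2_norm_eq_inner]
    by (simp add: C trace_add trace_sub trace_scaleR trace_outer power2_norm_eq_inner inner_simps inner_commute)
  have 4: "symm (second_moment Q (A j)) \<and> - (x j \<bullet> first_moment Q (A j)) \<ge> 0 \<and>
      psd (bmat (second_moment Q (A j)) (first_moment Q (A j)) (mass Q (A j)))" for j
  proof (intro conjI)
    show p: "psd (bmat (second_moment Q (A j)) (first_moment Q (A j)) (mass Q (A j)))"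
      by (rule psd_moments[OF sA])
    thus "symm (second_moment Q (A j))" by (simp add: psd_bmat_iff)
    have "0 \<le> (\<integral>\<theta>. - (indicator (A j) \<theta> * (x j \<bullet> \<theta>)) \<partial>Q)"
      by (rule integral_nonneg_AE) (auto simp: A_def indicator_def)
    thus "- (x j \<bullet> first_moment Q (A j)) \<ge> 0" by (simp add: inner_first_moment[OF sA])
  qed
  show ?thesis
    unfolding sdp_values_def mem_Collect_eq
    by (rule exI[of _ \<mu>], rule exI[of _ \<Sigma>], rule exI[of _ C], rule exI[of _ "\<Sigma> + outer \<mu>"],
        rule exI[of _ "\<lambda>j. mass Q (A j)"], rule exI[of _ "\<lambda>j. first_moment Q (A j)"],
        rule exI[of _ "\<lambda>j. second_moment Q (A j)"])
      (intro conjI ballI val \<Sigma> 1 2 3 C(1) low 4[THEN conjunct1] 4[THEN conjunct2, THEN conjunct1]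
        4[THEN conjunct2, THEN conjunct2])
qed

subsection \<open>Discrete measures with prescribed moments\<close>

text \<open>The measure is the image under \<open>p\<close> of a weighted point measure on the index
  set, so coinciding atoms simply add their weights.\<close>

lemma discrete_measure_exists:
  fixes p :: "'i \<Rightarrow> 'a::topological_space" and w :: "'i \<Rightarrow> real"
  assumes I: "finite I" and w: "\<And>i. i \<in> I \<Longrightarrow> 0 \<le> w i" and sum1: "(\<Sum>i\<in>I. w i) = 1"
  obtains Q where "prob_space Q" "sets Q = sets borel"
    "\<And>f :: 'a \<Rightarrow> real. f \<in> borel_measurable borel \<Longrightarrow> integrable Q f"
    "\<And>f :: 'a \<Rightarrow> real. f \<in> borel_measurable borel \<Longrightarrow> (\<integral>\<theta>. f \<theta> \<partial>Q) = (\<Sum>i\<in>I. w i * f (p i))"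
proof
  let ?P = "point_measure I (\<lambda>i. ennreal (w i))"
  have p: "p \<in> measurable ?P borel" by (simp add: measurable_point_measure_eq1)
  have "prob_space ?P"
  proof (rule prob_space_point_measure[OF I])
    show "(\<Sum>i\<in>I. ennreal (w i)) = 1" using sum1 w by (simp add: sum_ennreal)
  qed simp
  then interpret prob_space ?P .
  show "prob_space (distr ?P borel p)" using p by (rule prob_space_distr)
  show "sets (distr ?P borel p) = sets borel" by simp
  fix f :: "'a \<Rightarrow> real" assume f: "f \<in> borel_measurable borel"
  show "integrable (distr ?P borel p) f"
    using f p I by (simp add: integrable_distr_eq integrable_point_measure_finite)
  show "(\<integral>\<theta>. f \<theta> \<partial>distr ?P borel p) = (\<Sum>i\<in>I. w i * f (p i))"
    using f p I w by (simp add: integral_distr lebesgue_integral_point_measure_finite)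
qed

lemma uniform_atoms_exist:
  fixes K :: "real^'n^'n" and m :: "real^'n"
  assumes "psd K"
  obtains p :: "'n \<times> bool \<Rightarrow> real^'n" where
    "\<And>i. (\<Sum>a\<in>UNIV. p a $ i) = 2 * real CARD('n) * m $ i"
    "\<And>i k. (\<Sum>a\<in>UNIV. p a $ i * p a $ k) = 2 * real CARD('n) * (m $ i * m $ k + K $ i $ k)"
proof -
  obtain S where S: "psd S" "S ** S = K" using psd_square_root_exists[OF assms] by blast
  \<comment> \<open>The factor offsets the equal weights of the atoms: without it the covariance
    would be \<open>K\<close> divided by the dimension.\<close>
  define c where "c = sqrt (CARD('n))"
  have cc: "c * c = CARD('n)" by (simp add: c_def)
  \<comment> \<open>\<open>K\<close> is the sum of the rank-one matrices of the rows of its square root, so the atoms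
    \<open>m \<plusminus> c S\<^sub>k\<close> with equal weights have mean \<open>m\<close> and covariance \<open>K\<close>.\<close>
  define p :: "'n \<times> bool \<Rightarrow> real^'n" where
    "p = (\<lambda>(k, b). m + (if b then c else - c) *\<^sub>R (S $ k))"
  have sum_eq: "(\<Sum>a\<in>UNIV. f a) = (\<Sum>k\<in>UNIV. f (k, True) + f (k, False))" for f :: "'n \<times> bool \<Rightarrow> real"
    by (simp add: UNIV_Times_UNIV[symmetric] sum.cartesian_product' UNIV_bool add.commute del: UNIV_Times_UNIV)
  have K: "(\<Sum>l\<in>UNIV. S $ l $ i * S $ l $ k) = K $ i $ k" for i k
  proof -
    have "S $ l $ i = S $ i $ l" for l
      using arg_cong[OF symm_transpose[OF psd_symm[OF S(1)]], of "\<lambda>A. A $ i $ l"] by (simp add: transpose_def)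
    thus ?thesis by (simp add: S(2)[symmetric] matrix_matrix_mult_def)
  qed
  have "(\<Sum>a\<in>UNIV. p a $ i) = 2 * real CARD('n) * m $ i" for i
    by (simp add: sum_eq p_def)
  moreover have "(\<Sum>a\<in>UNIV. p a $ i * p a $ k) = 2 * real CARD('n) * (m $ i * m $ k + K $ i $ k)" for i k
  proof -
    have "p (l, True) $ i * p (l, True) $ k + p (l, False) $ i * p (l, False) $ k
        = 2 * (m $ i * m $ k) + 2 * (c * c) * (S $ l $ i * S $ l $ k)" for l
      by (simp add: p_def algebra_simps)
    hence "(\<Sum>a\<in>UNIV. p a $ i * p a $ k)
        = (\<Sum>l\<in>UNIV. 2 * (m $ i * m $ k) + 2 * (c * c) * (S $ l $ i * S $ l $ k))"
      by (simp only: sum_eq)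
    also have "\<dots> = 2 * real CARD('n) * (m $ i * m $ k) + 2 * real CARD('n) * K $ i $ k"
      by (simp add: sum.distrib sum_distrib_left[symmetric] K cc)
    finally show ?thesis by (simp add: algebra_simps)
  qed
  ultimately show ?thesis by (rule that)
qed

text \<open>Minimizing the form over \<open>t\<close> gives the Schur complement. For
  \<open>l = 0\<close> the form is affine in \<open>t\<close>, which forces \<open>z = 0\<close>,
  and the left side of the last claim is zero because division by zero yields zero.\<close>

lemma psd_bmat_schur:
  assumes "psd (bmat Z z l)"
  shows "l \<ge> 0" "l = 0 \<Longrightarrow> z = 0" "(z \<bullet> v)\<^sup>2 / l \<le> v \<bullet> (Z *v v)"
proof -
  have q: "0 \<le> v \<bullet> (Z *v v) + 2 * t * (z \<bullet> v) + l * t\<^sup>2" for v t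
    using assms by (simp add: psd_bmat_iff)
  show l: "l \<ge> 0" using q[of 0 1] by simp
  show "z = 0" if "l = 0"
  proof (rule ccontr)
    assume "z \<noteq> 0"
    thus False using q[of z "- (z \<bullet> (Z *v z) + 1) / (2 * (z \<bullet> z))"] that by (simp add: field_simps)
  qed
  show "(z \<bullet> v)\<^sup>2 / l \<le> v \<bullet> (Z *v v)"
  proof (cases "l = 0")
    case False
    have "0 \<le> v \<bullet> (Z *v v) + 2 * (- (z \<bullet> v) / l) * (z \<bullet> v) + l * (- (z \<bullet> v) / l)\<^sup>2" by (rule q)
    also have "\<dots> = v \<bullet> (Z *v v) - (z \<bullet> v)\<^sup>2 / l" using False by (simp add: power2_eq_square)
    finally show ?thesis by simp
  qed (use q[of v 0] in simp)
qed

text \<open>The atoms at \<open>z j / lam j\<close> lie outside the open cone, so only the residual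
  mass can lie inside it. The strict bound on the masses allows the residual moments to be
  normalized.\<close>

lemma chebyshev_measure_exists:
  fixes x :: "nat \<Rightarrow> real^'n"
  assumes M: "symm M"
    and Z: "\<And>j. j \<in> {1..J} \<Longrightarrow> psd (bmat (Z j) (z j) (lam j))"
    and xz: "\<And>j. j \<in> {1..J} \<Longrightarrow> x j \<bullet> z j \<le> 0"
    and low: "loewner_le (\<Sum>j\<in>{1..J}. bmat (Z j) (z j) (lam j)) (bmat M \<mu> 1)"
    and s: "(\<Sum>j\<in>{1..J}. lam j) < 1"
  obtains Q where "prob_space Q" "sets Q = sets borel" "has_mean_cov Q \<mu> (M - outer \<mu>)"
    "measure Q (Theta_int J x) \<le> 1 - (\<Sum>j\<in>{1..J}. lam j)"
proof -
  \<comment> \<open>\<open>s\<close>, \<open>r\<close> and \<open>R\<close> are the mass, first and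
    second moment left over by the atoms; \<open>m\<close> and \<open>K\<close> are the mean and
    covariance of this remainder after normalization.\<close>
  define s where "s = 1 - (\<Sum>j\<in>{1..J}. lam j)"
  define n where "n = real (CARD('n))"
  define r where "r = \<mu> - (\<Sum>j\<in>{1..J}. z j)"
  define m where "m = (1 / s) *\<^sub>R r"
  define R where "R = M - (\<Sum>j\<in>{1..J}. (1 / lam j) *\<^sub>R outer (z j))"
  define K where "K = (1 / s) *\<^sub>R R - outer m"
  have s0: "s > 0" using assms(5) by (simp add: s_def)
  have n0: "n > 0" by (simp add: n_def)
  note schur = psd_bmat_schur[OF Z]
  have "psd K"
    unfolding psd_def
  proof (intro conjI allI)
    show "symm K" unfolding K_def R_def by (intro symm_diff symm_scaleR symm_outer symm_sum M)
    \<comment> \<open>The Schur complement of the slack in \<open>low\<close> bounds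
      \<open>outer r\<close> divided by \<open>s\<close> by \<open>M\<close> minus the sum of the
      \<open>Z j\<close>; those of the single blocks then replace each \<open>Z j\<close> by the
      smaller \<open>outer (z j)\<close> divided by \<open>lam j\<close>.\<close>
    fix v
    have "(r \<bullet> v)\<^sup>2 / s \<le> v \<bullet> ((M - (\<Sum>j\<in>{1..J}. Z j)) *v v)"
      using psd_bmat_schur(3) low unfolding loewner_le_def bmat_sum bmat_diff r_def s_def by blast
    also have "\<dots> = v \<bullet> (M *v v) - (\<Sum>j\<in>{1..J}. v \<bullet> (Z j *v v))"
      by (simp add: matrix_vector_mult_diff_rdistrib inner_diff_right inner_sum_matrix)
    also have "\<dots> \<le> v \<bullet> (M *v v) - (\<Sum>j\<in>{1..J}. (z j \<bullet> v)\<^sup>2 / lam j)"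
      by (intro diff_left_mono sum_mono schur(3)) auto
    also have "\<dots> = v \<bullet> (R *v v)"
      by (simp add: R_def matrix_vector_mult_diff_rdistrib inner_diff_right inner_sum_matrix
          scaleR_matrix_vector_assoc[symmetric] inner_outer)
    finally have "(r \<bullet> v)\<^sup>2 / s / s \<le> v \<bullet> (R *v v) / s" using s0 by (intro divide_right_mono) simp_all
    thus "0 \<le> v \<bullet> (K *v v)"
      using s0 by (simp add: K_def matrix_vector_mult_diff_rdistrib inner_diff_right
          scaleR_matrix_vector_assoc[symmetric] inner_outer m_def power2_eq_square)
  qed
  obtain p where p: "\<And>i. (\<Sum>a\<in>(UNIV :: ('n \<times> bool) set). p a $ i) = 2 * n * m $ i"
    "\<And>i k. (\<Sum>a\<in>(UNIV :: ('n \<times> bool) set). p a $ i * p a $ k) = 2 * n * (m $ i * m $ k + K $ i $ k)"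
    by (rule uniform_atoms_exist[OF \<open>psd K\<close>, of m, folded n_def]) (rule that)
  define w where "w = case_sum lam (\<lambda>a :: 'n \<times> bool. s / (2 * n))"
  define q where "q = case_sum (\<lambda>j. (1 / lam j) *\<^sub>R z j) p"
  define I where "I = {1..J} <+> (UNIV :: ('n \<times> bool) set)"
  have sumI: "(\<Sum>i\<in>I. f i) = (\<Sum>j\<in>{1..J}. f (Inl j)) + (\<Sum>a\<in>UNIV. f (Inr a))" for f :: "_ \<Rightarrow> real"
    by (simp add: I_def sum.Plus)
  have I: "finite I" by (simp add: I_def)
  have w0: "0 \<le> w i" if "i \<in> I" for i
    using that s0 n0 schur(1) by (auto simp: I_def w_def)
  have "(\<Sum>i\<in>I. w i) = 1"
    using n0 by (simp add: sumI w_def n_def[symmetric]) (simp add: s_def diff_divide_distrib)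
  from discrete_measure_exists[OF I w0 this, of q] obtain Q where
    Q: "prob_space Q" "sets Q = sets borel"
      "\<And>f :: real^'n \<Rightarrow> real. f \<in> borel_measurable borel \<Longrightarrow> integrable Q f"
    and int: "\<And>f :: real^'n \<Rightarrow> real. f \<in> borel_measurable borel \<Longrightarrow> (\<integral>\<theta>. f \<theta> \<partial>Q) = (\<Sum>i\<in>I. w i * f (q i))"
    by blast
  interpret Q: prob_space Q by fact
  have meas: "(\<lambda>\<theta> :: real^'n. \<theta> $ i) \<in> borel_measurable borel" for i
    by (intro borel_measurable_continuous_onI continuous_intros)
  \<comment> \<open>If \<open>lam j = 0\<close>, the atom sits at the origin with no mass, and
    \<open>z j = 0\<close> means that no first moment is lost.\<close>
  have lz: "lam j * (z j $ i / lam j) = z j $ i" if "j \<in> {1..J}" for i j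
    using schur(2)[OF that] by (cases "lam j = 0") auto
  have 1: "(\<integral>\<theta>. \<theta> $ i \<partial>Q) = \<mu> $ i" for i
  proof -
    have "(\<integral>\<theta>. \<theta> $ i \<partial>Q) = (\<Sum>j\<in>{1..J}. lam j * (z j $ i / lam j)) + s / (2 * n) * (\<Sum>a\<in>UNIV. p a $ i)"
      by (simp add: int[OF meas] sumI w_def q_def sum_distrib_left)
    also have "(\<Sum>j\<in>{1..J}. lam j * (z j $ i / lam j)) = (\<Sum>j\<in>{1..J}. z j $ i)"
      by (intro sum.cong refl lz)
    also have "s / (2 * n) * (\<Sum>a\<in>UNIV. p a $ i) = r $ i"
      using s0 n0 by (simp add: p m_def)
    finally show ?thesis by (simp add: r_def)
  qed
  have 2: "(\<integral>\<theta>. \<theta> $ i * \<theta> $ k \<partial>Q) = M $ i $ k" for i k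
  proof -
    have "(\<integral>\<theta>. \<theta> $ i * \<theta> $ k \<partial>Q) = (\<Sum>j\<in>{1..J}. lam j * ((z j $ i / lam j) * (z j $ k / lam j)))
       + s / (2 * n) * (\<Sum>a\<in>UNIV. p a $ i * p a $ k)"
      by (subst int, intro borel_measurable_times meas)
        (simp add: sumI w_def q_def sum_distrib_left)
    also have "(\<Sum>j\<in>{1..J}. lam j * ((z j $ i / lam j) * (z j $ k / lam j)))
       = (\<Sum>j\<in>{1..J}. (1 / lam j) * (z j $ i * z j $ k))"
    proof (rule sum.cong[OF refl])
      fix j assume "j \<in> {1..J}"
      show "lam j * ((z j $ i / lam j) * (z j $ k / lam j)) = (1 / lam j) * (z j $ i * z j $ k)"
        by (cases "lam j = 0") auto
    qed
    also have "s / (2 * n) * (\<Sum>a\<in>UNIV. p a $ i * p a $ k) = s * (m $ i * m $ k + K $ i $ k)"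
      using n0 by (simp add: p)
    also have "\<dots> = R $ i $ k"
      using s0 by (simp add: K_def outer_nth)
    finally show ?thesis by (simp add: R_def outer_nth)
  qed
  have "measure Q (Theta_int J x) = (\<integral>\<theta>. indicator (Theta_int J x) \<theta> \<partial>Q)"
    using Theta_int_sets[of J x] Q(2) by simp
  also have "\<dots> = (\<Sum>i\<in>I. w i * indicator (Theta_int J x) (q i))"
    by (intro int borel_measurable_indicator Theta_int_sets)
  also have "\<dots> \<le> (\<Sum>i\<in>I. case_sum (\<lambda>_. 0) (\<lambda>_. s / (2 * n)) i)"
  proof (rule sum_mono)
    fix i assume i: "i \<in> I"
    show "w i * indicator (Theta_int J x) (q i) \<le> case_sum (\<lambda>_. 0) (\<lambda>_. s / (2 * n)) i"
    proof (cases i)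
      case (Inl j)
      hence j: "j \<in> {1..J}" using i by (auto simp: I_def)
      have "lam j = 0 \<or> q i \<notin> Theta_int J x"
      proof (rule disjCI)
        assume "\<not> q i \<notin> Theta_int J x"
        hence "x j \<bullet> z j / lam j > 0" using j Inl by (auto simp: Theta_int_def q_def)
        thus "lam j = 0" using xz[OF j] schur(1)[OF j] by (simp add: zero_less_divide_iff)
      qed
      thus ?thesis using Inl by (auto simp: w_def indicator_def)
    qed (use s0 n0 in \<open>simp add: w_def indicator_def\<close>)
  qed
  also have "\<dots> = s" using n0 by (simp add: sumI n_def[symmetric])
  finally have "measure Q (Theta_int J x) \<le> s" .
  moreover have "has_mean_cov Q \<mu> (M - outer \<mu>)"
    unfolding has_mean_cov_iff[OF Q(1)] diff_add_cancel
    by (intro conjI allI 1 2 Q(3) meas borel_measurable_times)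
  ultimately show ?thesis unfolding s_def by (rule that[OF Q(1,2), rotated])
qed

section \<open>From a feasible point to measures in the ball\<close>

lemma sdp_value_gelbrich_ball:
  fixes x :: "nat \<Rightarrow> real^'n"
  assumes \<rho>: "\<rho> \<ge> 0" and \<Sigma>h: "psd \<Sigma>h" and val: "val \<in> sdp_values J x \<mu>h \<Sigma>h \<rho>" and e: "0 < e" "e < 1"
  shows "\<exists>Q\<in>gelbrich_ball \<mu>h \<Sigma>h \<rho>. measure Q (Theta_int J x) \<le> val + e"
proof -
  obtain \<mu> \<Sigma> C M lam z Z where feas: "val = 1 - (\<Sum>j\<in>{1..J}. lam j) \<and> psd \<Sigma> \<and> psd M \<and>
      (\<forall>j\<in>{1..J}. symm (Z j) \<and> - (x j \<bullet> z j) \<ge> 0 \<and> psd (bmat (Z j) (z j) (lam j))) \<and>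
      loewner_le (\<Sum>j\<in>{1..J}. bmat (Z j) (z j) (lam j)) (bmat M \<mu> 1) \<and>
      psd (blockmat \<Sigma> C (transpose C) \<Sigma>h) \<and>
      psd (bmat (M - \<Sigma>) \<mu> 1) \<and>
      (norm \<mu>h)\<^sup>2 - 2 * (\<mu>h \<bullet> \<mu>) + trace (M + \<Sigma>h - 2 *\<^sub>R C) \<le> \<rho>\<^sup>2"
    using val unfolding sdp_values_def mem_Collect_eq by (elim exE) (rule that)
  hence val: "val = 1 - (\<Sum>j\<in>{1..J}. lam j)"
    and \<Sigma>: "psd \<Sigma>" and M: "psd M"
    and Z: "\<And>j. j \<in> {1..J} \<Longrightarrow> psd (bmat (Z j) (z j) (lam j))"
    and xz: "\<And>j. j \<in> {1..J} \<Longrightarrow> x j \<bullet> z j \<le> 0"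
    and low: "loewner_le (\<Sum>j\<in>{1..J}. bmat (Z j) (z j) (lam j)) (bmat M \<mu> 1)"
    and C: "psd (blockmat \<Sigma> C (transpose C) \<Sigma>h)"
    and MS: "psd (bmat (M - \<Sigma>) \<mu> 1)"
    and tr: "(norm \<mu>h)\<^sup>2 - 2 * (\<mu>h \<bullet> \<mu>) + trace (M + \<Sigma>h - 2 *\<^sub>R C) \<le> \<rho>\<^sup>2"
    by simp_all
  \<comment> \<open>The covariance that belongs to \<open>\<mu>\<close> and \<open>M\<close>. By a
    Schur complement the constraint \<open>MS\<close> says that it dominates
    \<open>\<Sigma>\<close>, so \<open>C\<close> remains an admissible coupling when
    \<open>\<Sigma>\<close> is replaced by \<open>T\<close>.\<close>
  define T where "T = M - outer \<mu>"
  have ST: "v \<bullet> (\<Sigma> *v v) \<le> v \<bullet> (T *v v)" for v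
    using psd_bmat_schur(3)[OF MS, of v]
    by (simp add: T_def matrix_vector_mult_diff_rdistrib inner_diff_right inner_outer)
  have symT: "symm T" using M by (simp add: T_def symm_diff symm_outer psd_symm)
  have psdT: "psd T" using ST psd_nonneg[OF \<Sigma>] symT by (auto simp: psd_def intro: order_trans)
  have block: "psd (blockmat T C (transpose C) \<Sigma>h)"
  proof -
    have "0 \<le> v \<bullet> (T *v v) + 2 * (v \<bullet> (C *v w)) + w \<bullet> (\<Sigma>h *v w)" for v w
    proof -
      have "0 \<le> v \<bullet> (\<Sigma> *v v) + 2 * (v \<bullet> (C *v w)) + w \<bullet> (\<Sigma>h *v w)"
        using C by (simp add: psd_blockmat_iff)
      thus ?thesis using ST[of v] by linarith
    qed
    thus ?thesis using symT \<Sigma>h by (simp add: psd_blockmat_iff psd_symm)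
  qed
  have G: "gelbrich (\<mu>, T) (\<mu>h, \<Sigma>h) \<le> \<rho>"
    using tr trace_coupling_le[OF psdT \<Sigma>h block] unfolding gelbrich_le_iff[OF \<rho>] power2_norm_eq_inner
    by (simp add: T_def trace_add trace_sub trace_scaleR trace_outer power2_norm_eq_inner inner_simps inner_commute)
  \<comment> \<open>Since the masses sum to at most one, scaling by \<open>1 - e\<close> leaves a
    residual mass of at least \<open>e\<close>.\<close>
  let ?c = "1 - e"
  have scale: "bmat (?c *\<^sub>R A) (?c *\<^sub>R a) (?c * l) = ?c *\<^sub>R bmat A a l" for A and a :: "real^'n" and l
    by (simp add: vec_eq_iff bmat_def blockmat_def colv_def rowv_def scal_def split: sum.splits)
  have SB: "psd (\<Sum>j\<in>{1..J}. bmat (Z j) (z j) (lam j))"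
    by (intro psd_sum Z)
  \<comment> \<open>The lower right entry of the positive semidefinite slack matrix is
    nonnegative.\<close>
  have sum1: "(\<Sum>j\<in>{1..J}. lam j) \<le> 1"
    using psd_bmat_schur(1)[OF low[unfolded loewner_le_def bmat_sum bmat_diff]] by simp
  obtain Q where "prob_space Q" "sets Q = sets borel" "has_mean_cov Q \<mu> (M - outer \<mu>)"
    "measure Q (Theta_int J x) \<le> 1 - (\<Sum>j\<in>{1..J}. ?c * lam j)"
  proof (rule chebyshev_measure_exists)
    show "symm M" using M by (rule psd_symm)
    show "psd (bmat (?c *\<^sub>R Z j) (?c *\<^sub>R z j) (?c * lam j))" if "j \<in> {1..J}" for j
      unfolding scale using Z[OF that] e by (intro psd_scaleR) auto
    show "x j \<bullet> (?c *\<^sub>R z j) \<le> 0" if "j \<in> {1..J}" for j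
      using xz[OF that] e by (simp add: mult_nonneg_nonpos)
    let ?S = "\<Sum>j\<in>{1..J}. bmat (Z j) (z j) (lam j)"
    have "(\<Sum>j\<in>{1..J}. bmat (?c *\<^sub>R Z j) (?c *\<^sub>R z j) (?c * lam j)) = ?c *\<^sub>R ?S"
      by (simp only: scale scaleR_sum_right)
    \<comment> \<open>The new slack is the old one plus \<open>e\<close> times a sum of positive
      semidefinite blocks.\<close>
    hence "bmat M \<mu> 1 - (\<Sum>j\<in>{1..J}. bmat (?c *\<^sub>R Z j) (?c *\<^sub>R z j) (?c * lam j)) = (bmat M \<mu> 1 - ?S) + e *\<^sub>R ?S"
      by (simp add: algebra_simps)
    thus "loewner_le (\<Sum>j\<in>{1..J}. bmat (?c *\<^sub>R Z j) (?c *\<^sub>R z j) (?c * lam j)) (bmat M \<mu> 1)"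
      unfolding loewner_le_def using low[unfolded loewner_le_def] SB e
      by (simp only: psd_add psd_scaleR less_imp_le)
    have "(\<Sum>j\<in>{1..J}. ?c * lam j) = ?c * (\<Sum>j\<in>{1..J}. lam j)" by (simp only: sum_distrib_left)
    also have "\<dots> \<le> ?c * 1" using sum1 e by (intro mult_left_mono) auto
    also have "\<dots> < 1" using e by simp
    finally show "(\<Sum>j\<in>{1..J}. ?c * lam j) < 1" .
  qed
  moreover have "1 - (\<Sum>j\<in>{1..J}. ?c * lam j) \<le> val + e"
  proof -
    have "1 - (\<Sum>j\<in>{1..J}. ?c * lam j) = val + e * (\<Sum>j\<in>{1..J}. lam j)"
      by (simp only: val sum_distrib_left[symmetric]) (simp add: algebra_simps)
    thus ?thesis using mult_left_mono[OF sum1, of e] e by simp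
  qed
  ultimately show ?thesis
    using psdT G by (intro bexI[of _ Q]) (auto simp: gelbrich_ball_def T_def)
qed

theorem theorem1:
  fixes J :: nat and x :: "nat \<Rightarrow> real^'n" and \<rho> :: real
    and \<mu>h :: "real^'n" and \<Sigma>h :: "real^'n^'n"
  assumes "\<rho> \<ge> 0" and "psd \<Sigma>h"
  shows "(INF v \<in> sdp_values J x \<mu>h \<Sigma>h \<rho>. ereal v)
           = (INF Q \<in> gelbrich_ball \<mu>h \<Sigma>h \<rho>. ereal (measure Q (Theta_int J x)))
       \<and> (INF Q \<in> gelbrich_ball \<mu>h \<Sigma>h \<rho>. ereal (measure Q (Theta_int J x)))
           \<le> (INF Q \<in> gelbrich_ball \<mu>h \<Sigma>h \<rho>. ereal (measure Q (Theta J x)))"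
proof (intro conjI antisym)
  show "(INF v \<in> sdp_values J x \<mu>h \<Sigma>h \<rho>. ereal v)
      \<le> (INF Q \<in> gelbrich_ball \<mu>h \<Sigma>h \<rho>. ereal (measure Q (Theta_int J x)))"
    using gelbrich_ball_sdp_value[OF assms] by (intro INF_greatest INF_lower)
  show "(INF Q \<in> gelbrich_ball \<mu>h \<Sigma>h \<rho>. ereal (measure Q (Theta_int J x)))
      \<le> (INF v \<in> sdp_values J x \<mu>h \<Sigma>h \<rho>. ereal v)"
  proof (rule INF_greatest)
    fix v assume v: "v \<in> sdp_values J x \<mu>h \<Sigma>h \<rho>"
    show "(INF Q \<in> gelbrich_ball \<mu>h \<Sigma>h \<rho>. ereal (measure Q (Theta_int J x))) \<le> ereal v"
    proof (rule ereal_le_epsilon2)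
      fix e :: real assume "0 < e"
      \<comment> \<open>The minimum keeps the scaling factor \<open>1 - e\<close> of the preceding
        lemma positive for large \<open>e\<close>.\<close>
      hence "0 < min e (1 / 2)" "min e (1 / 2) < 1" by auto
      from sdp_value_gelbrich_ball[OF assms v this] obtain Q
        where Q: "Q \<in> gelbrich_ball \<mu>h \<Sigma>h \<rho>" "measure Q (Theta_int J x) \<le> v + min e (1 / 2)" by blast
      have "(INF Q \<in> gelbrich_ball \<mu>h \<Sigma>h \<rho>. ereal (measure Q (Theta_int J x))) \<le> ereal (measure Q (Theta_int J x))"
        using Q(1) by (rule INF_lower)
      also have "\<dots> \<le> ereal v + ereal e" using Q(2) by simp
      finally show "(INF Q \<in> gelbrich_ball \<mu>h \<Sigma>h \<rho>. ereal (measure Q (Theta_int J x))) \<le> ereal v + ereal e" .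
    qed
  qed
  show "(INF Q \<in> gelbrich_ball \<mu>h \<Sigma>h \<rho>. ereal (measure Q (Theta_int J x)))
      \<le> (INF Q \<in> gelbrich_ball \<mu>h \<Sigma>h \<rho>. ereal (measure Q (Theta J x)))"
  proof (rule INF_mono)
    fix Q assume Q: "Q \<in> gelbrich_ball \<mu>h \<Sigma>h \<rho>"
    then interpret prob_space Q by (simp add: gelbrich_ball_def)
    have "sets Q = sets borel" using Q by (simp add: gelbrich_ball_def)
    hence "measure Q (Theta_int J x) \<le> measure Q (Theta J x)"
      using Theta_sets[of J x] by (intro finite_measure_mono) (auto simp: Theta_def Theta_int_def intro: less_imp_le)
    thus "\<exists>P\<in>gelbrich_ball \<mu>h \<Sigma>h \<rho>. ereal (measure P (Theta_int J x)) \<le> ereal (measure Q (Theta J x))"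
      using Q by auto
  qed
qed

end
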